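(* Let $1\le r\le n$. For any finite dimensional $kE$-module $M$ and any positive integer $j$, the subsets $\operatorname{Rad}^j(r,\mathbb V)_M$ and $\operatorname{Soc}^j(r,\mathbb V)_M$ are Zariski closed subsets of $\operatorname{Grass}(r,\mathbb V)$.
   Context: $k$ is an algebraically closed field of characteristic $p>0$, $E$ is an elementary abelian $p$-group of rank $n\ge1$, and $kE\cong k[x_1,\dots,x_n]/(x_1^p,\dots,x_n^p)$. $\mathbb V\subset\operatorname{Rad}(kE)$ is a fixed linear subspace such that $\mathbb V\hookrightarrow\operatorname{Rad}(kE)\to\operatorname{Rad}(kE)/\operatorname{Rad}^2(kE)$ is an isomorphism. $\operatorname{Grass}(r,\mathbb V)$ is the Grassmann variety of $r$-dimensional linear subspaces ($r$-planes) of $\mathbb V$. For an $r$-plane $U\subset\mathbb V$, $\operatorname{Rad}^j_U(M)$ is the span of all $u_1\cdots u_j m$ with $u_i\in U$, $m\in M$, and $\operatorname{Soc}^j_U(M)=\{m\in M: u_1\cdots u_jm=0\text{ for all }u_1,\dots,u_j\in U\}$. Define $$\operatorname{Rad}^j(r,\mathbb V)_M=\{U\in\operatorname{Grass}(r,\mathbb V):\dim\operatorname{Rad}^j_U(M)<\max_{U'\in\operatorname{Grass}(r,\mathbb V)}\dim\operatorname{Rad}^j_{U'}(M)\},$$ $$\operatorname{Soc}^j(r,\mathbb V)_M=\{U\in\operatorname{Grass}(r,\mathbb V):\dim\operatorname{Soc}^j_U(M)>\min_{U'\in\operatorname{Grass}(r,\mathbb V)}\dim\operatorname{Soc}^j_{U'}(M)\}.$$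 *)

theory Defs
  imports
    "HOL-Library.Poly_Mapping"
    "HOL-Computational_Algebra.Polynomial"
    "Jordan_Normal_Form.Determinant"
    "Jordan_Normal_Form.DL_Submatrix"
begin

text \<open>
  The group \<open>E\<close> is an additively written type \<open>'e\<close>, and the group algebra \<open>kE\<close> is the type
  \<open>'e \<Rightarrow>\<^sub>0 'k\<close> with its convolution product; the group element \<open>g\<close> is \<open>Poly_Mapping.single g 1\<close> and
  \<open>c \<in> k\<close> embeds as \<open>Poly_Mapping.single 0 c\<close>.  A \<open>kE\<close>-module is an instance \<open>act\<close> of the locale
  \<open>Modules.module\<close> (the qualifier is needed because HOL-Algebra has another \<open>module\<close>).
  Taking \<open>act = (*)\<close> gives the regular module, whose submodules are the ideals of \<open>kE\<close>.
\<close>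

definition restrict_scalars ::
    "(('e::comm_monoid_add \<Rightarrow>\<^sub>0 'k::field) \<Rightarrow> 'm \<Rightarrow> 'm) \<Rightarrow> 'k \<Rightarrow> 'm::ab_group_add \<Rightarrow> 'm" where
  "restrict_scalars act c m = act (Poly_Mapping.single 0 c) m"

lemma vector_space_restrict_scalars:
  fixes act :: "('e::comm_monoid_add \<Rightarrow>\<^sub>0 'k::field) \<Rightarrow> 'm::ab_group_add \<Rightarrow> 'm"
  assumes "Modules.module act"
  shows "vector_space (restrict_scalars act)"
proof -
  interpret Modules.module act by fact
  show ?thesis
    by unfold_locales
      (simp_all add: restrict_scalars_def scale_right_distrib scale_left_distrib single_add mult_single)
qed

abbreviation kscale :: "'k \<Rightarrow> ('e::comm_monoid_add \<Rightarrow>\<^sub>0 'k::field) \<Rightarrow> ('e \<Rightarrow>\<^sub>0 'k)" where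
  "kscale \<equiv> restrict_scalars (*)"


definition maximal_ideal :: "'a::comm_ring_1 set \<Rightarrow> bool" where
  "maximal_ideal I \<longleftrightarrow> Modules.module.subspace (*) I \<and> I \<noteq> UNIV \<and>
     (\<forall>J. Modules.module.subspace (*) J \<and> I \<subseteq> J \<longrightarrow> J = I \<or> J = UNIV)"

definition jacobson_radical :: "'a::comm_ring_1 set" where
  "jacobson_radical = \<Inter>{I. maximal_ideal I}"

definition jacobson_radical_sq :: "'a::comm_ring_1 set" where
  "jacobson_radical_sq =
     Modules.module.span (*) {x * y | x y. x \<in> jacobson_radical \<and> y \<in> jacobson_radical}"

text \<open>
  A linear subspace \<open>V\<close> of \<open>Rad(kE)\<close> such that \<open>V \<rightarrow> Rad(kE)/Rad\<^sup>2(kE)\<close> is bijective; the quotient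
  is the set of cosets of \<open>Rad\<^sup>2(kE)\<close> in \<open>Rad(kE)\<close>.
\<close>
definition radical_complement :: "('e::comm_monoid_add \<Rightarrow>\<^sub>0 'k::field) set \<Rightarrow> bool" where
  "radical_complement V \<longleftrightarrow>
     Modules.module.subspace kscale V \<and> V \<subseteq> jacobson_radical \<and>
     bij_betw (\<lambda>v. (+) v ` jacobson_radical_sq) V
       ((\<lambda>x. (+) x ` jacobson_radical_sq) ` jacobson_radical)"


definition Grass :: "nat \<Rightarrow> ('e::comm_monoid_add \<Rightarrow>\<^sub>0 'k::field) set \<Rightarrow> ('e \<Rightarrow>\<^sub>0 'k) set set" where
  "Grass r V = {U. Modules.module.subspace kscale U \<and> U \<subseteq> V \<and> vector_space.dim kscale U = r}"

definition ordered_basis ::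
    "('k::field \<Rightarrow> 'v::ab_group_add \<Rightarrow> 'v) \<Rightarrow> 'v list \<Rightarrow> 'v set \<Rightarrow> bool" where
  "ordered_basis scale bs W \<longleftrightarrow> distinct bs \<and> \<not> Modules.module.dependent scale (set bs) \<and>
     Modules.module.span scale (set bs) = W"

text \<open>
  Coordinates of \<open>us!0 \<and> \<dots> \<and> us!(r - 1)\<close> in the exterior power \<open>\<Lambda>\<^sup>r V\<close>, with respect to the basis
  induced by the ordered basis \<open>vs\<close> of \<open>V\<close>: the coordinate at an \<open>r\<close>-subset \<open>I\<close> of
  \<open>{..<length vs}\<close> is the maximal minor with columns \<open>I\<close> of the coordinate matrix of \<open>us\<close>.
\<close>
definition pluecker ::
    "('k::field \<Rightarrow> 'v::ab_group_add \<Rightarrow> 'v) \<Rightarrow> 'v list \<Rightarrow> 'v list \<Rightarrow> nat set \<Rightarrow> 'k" where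
  "pluecker scale vs us I =
     det (submatrix (mat (length us) (length vs)
        (\<lambda>(i, j). Modules.module.representation scale (set vs) (us ! i) (vs ! j))) UNIV I)"

text \<open>
  A polynomial over \<open>'k\<close> in the variables \<open>'i\<close> is an element of \<open>('i \<Rightarrow>\<^sub>0 nat) \<Rightarrow>\<^sub>0 'k\<close>, mapping
  exponent vectors to coefficients.
\<close>
definition mpoly_eval :: "(('i \<Rightarrow>\<^sub>0 nat) \<Rightarrow>\<^sub>0 'k::comm_ring_1) \<Rightarrow> ('i \<Rightarrow> 'k) \<Rightarrow> 'k" where
  "mpoly_eval f x = (\<Sum>a\<in>Poly_Mapping.keys f.
       Poly_Mapping.lookup f a *
       (\<Prod>i\<in>Poly_Mapping.keys a. x i ^ Poly_Mapping.lookup a i))"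

definition homogeneous_in :: "'i set \<Rightarrow> (('i \<Rightarrow>\<^sub>0 nat) \<Rightarrow>\<^sub>0 'k::comm_ring_1) \<Rightarrow> bool" where
  "homogeneous_in X f \<longleftrightarrow>
     (\<exists>d. \<forall>a\<in>Poly_Mapping.keys f. Poly_Mapping.keys a \<subseteq> X \<and>
       (\<Sum>i\<in>Poly_Mapping.keys a. Poly_Mapping.lookup a i) = d)"

text \<open>
  The Zariski topology on the Grassmannian is induced by the Pluecker embedding into the projective
  space of \<open>\<Lambda>\<^sup>r V\<close>: a closed set is the common zero locus of a set \<open>F\<close> of homogeneous polynomials in
  the Pluecker coordinates.  Changing the basis \<open>us\<close> of \<open>U\<close> multiplies all Pluecker coordinates by
  one nonzero scalar, so vanishing at \<open>U\<close> does not depend on \<open>us\<close>; changing \<open>vs\<close> is a linear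
  change of the Pluecker coordinates, so closedness does not depend on \<open>vs\<close>.
\<close>
definition zariski_closed_Grass ::
    "nat \<Rightarrow> ('e::comm_monoid_add \<Rightarrow>\<^sub>0 'k::field) set \<Rightarrow> ('e \<Rightarrow>\<^sub>0 'k) set set \<Rightarrow> bool" where
  "zariski_closed_Grass r V Z \<longleftrightarrow>
     (\<exists>vs F. ordered_basis kscale vs V \<and>
        (\<forall>f\<in>F. homogeneous_in {I. I \<subseteq> {..<length vs} \<and> card I = r} f) \<and>
        Z = {U \<in> Grass r V. \<forall>us. ordered_basis kscale us U \<longrightarrow>
               (\<forall>f\<in>F. mpoly_eval f (pluecker kscale vs us) = 0)})"


definition Rad_pow ::
    "(('e::comm_monoid_add \<Rightarrow>\<^sub>0 'k::field) \<Rightarrow> 'm::ab_group_add \<Rightarrow> 'm) \<Rightarrow> nat \<Rightarrow> ('e \<Rightarrow>\<^sub>0 'k) set \<Rightarrow> 'm set"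
  where "Rad_pow act j U = Modules.module.span (restrict_scalars act)
     {act (\<Prod>i<j. u i) m | u m. \<forall>i<j. u i \<in> U}"

definition Soc_pow ::
    "(('e::comm_monoid_add \<Rightarrow>\<^sub>0 'k::field) \<Rightarrow> 'm::ab_group_add \<Rightarrow> 'm) \<Rightarrow> nat \<Rightarrow> ('e \<Rightarrow>\<^sub>0 'k) set \<Rightarrow> 'm set"
  where "Soc_pow act j U = {m. \<forall>u. (\<forall>i<j. u i \<in> U) \<longrightarrow> act (\<Prod>i<j. u i) m = 0}"

definition Rad_locus ::
    "(('e::comm_monoid_add \<Rightarrow>\<^sub>0 'k::field) \<Rightarrow> 'm::ab_group_add \<Rightarrow> 'm) \<Rightarrow> nat \<Rightarrow> nat
      \<Rightarrow> ('e \<Rightarrow>\<^sub>0 'k) set \<Rightarrow> ('e \<Rightarrow>\<^sub>0 'k) set set" where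
  "Rad_locus act j r V = {U \<in> Grass r V.
     vector_space.dim (restrict_scalars act) (Rad_pow act j U)
       < Max ((\<lambda>U'. vector_space.dim (restrict_scalars act) (Rad_pow act j U')) ` Grass r V)}"

definition Soc_locus ::
    "(('e::comm_monoid_add \<Rightarrow>\<^sub>0 'k::field) \<Rightarrow> 'm::ab_group_add \<Rightarrow> 'm) \<Rightarrow> nat \<Rightarrow> nat
      \<Rightarrow> ('e \<Rightarrow>\<^sub>0 'k) set \<Rightarrow> ('e \<Rightarrow>\<^sub>0 'k) set set" where
  "Soc_locus act j r V = {U \<in> Grass r V.
     vector_space.dim (restrict_scalars act) (Soc_pow act j U)
       > Min ((\<lambda>U'. vector_space.dim (restrict_scalars act) (Soc_pow act j U')) ` Grass r V)}"

end

theory Submission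
  imports Defs
begin

text \<open>
  Fix a basis of \<open>V\<close>, and let \<open>A\<close> be the coordinate matrix of a basis of an \<open>r\<close>-plane \<open>U\<close>.  For each
  choice \<open>c\<close> of \<open>r\<close> columns, the rows of \<open>adj(A\<^sub>c) A\<close> lie in \<open>U\<close>, their coordinates are up to sign
  Pluecker coordinates of \<open>U\<close>, and they span \<open>U\<close> when \<open>det A\<^sub>c \<noteq> 0\<close>, which happens for some \<open>c\<close>.
  Let \<open>w\<^sub>1, \<dots>, w\<^sub>r\<close> be these rows.  The conditions on the dimensions of \<open>Rad\<^sup>j\<^sub>U(M)\<close> and
  \<open>Soc\<^sup>j\<^sub>U(M)\<close> bound the rank of the family of operators \<open>w\<^sub>i\<^sub>1 \<cdots> w\<^sub>i\<^sub>j\<close> on \<open>M\<close>, put side by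
  side or on top of each other.  A rank bound is the vanishing of determinants, which are here
  homogeneous in the Pluecker coordinates.  The choices \<open>c\<close> with \<open>det A\<^sub>c = 0\<close> impose no extra
  condition, because their rows still lie in \<open>U\<close>.
\<close>

section \<open>Homogeneous polynomial functions\<close>

text \<open>Sums over different supports become comparable over a common index set; the condition
  \<open>h i 0 = 0\<close> makes the added terms vanish.\<close>

lemma sum_keys_superset:
  assumes "finite A" "Poly_Mapping.keys a \<subseteq> A" "\<And>i. h i 0 = 0"
  shows "(\<Sum>i\<in>Poly_Mapping.keys a. h i (Poly_Mapping.lookup a i)) = (\<Sum>i\<in>A. h i (Poly_Mapping.lookup a i))"
  by (rule sum.mono_neutral_left) (use assms in \<open>auto simp: in_keys_iff\<close>)

lemma prod_keys_superset:
  assumes "finite A" "Poly_Mapping.keys a \<subseteq> A" "\<And>i. h i 0 = 1"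
  shows "(\<Prod>i\<in>Poly_Mapping.keys a. h i (Poly_Mapping.lookup a i)) = (\<Prod>i\<in>A. h i (Poly_Mapping.lookup a i))"
  by (rule prod.mono_neutral_left) (use assms in \<open>auto simp: in_keys_iff\<close>)

section \<open>Degree and evaluation of monomials and polynomials\<close>

definition monomial_degree :: "('i \<Rightarrow>\<^sub>0 nat) \<Rightarrow> nat" where
  "monomial_degree a = (\<Sum>i\<in>Poly_Mapping.keys a. Poly_Mapping.lookup a i)"

definition monomial_eval :: "('i \<Rightarrow>\<^sub>0 nat) \<Rightarrow> ('i \<Rightarrow> 'k::comm_ring_1) \<Rightarrow> 'k" where
  "monomial_eval a x = (\<Prod>i\<in>Poly_Mapping.keys a. x i ^ Poly_Mapping.lookup a i)"

lemma monomial_degree_add: "monomial_degree (a + b) = monomial_degree a + monomial_degree b"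
proof -
  let ?A = "Poly_Mapping.keys a \<union> Poly_Mapping.keys b"
  have "monomial_degree c = (\<Sum>i\<in>?A. Poly_Mapping.lookup c i)" if "Poly_Mapping.keys c \<subseteq> ?A" for c
    unfolding monomial_degree_def using that by (intro sum_keys_superset) auto
  then show ?thesis
    by (simp add: keys_add lookup_add sum.distrib)
qed

lemma monomial_eval_add: "monomial_eval (a + b) x = monomial_eval a x * monomial_eval b x"
proof -
  let ?A = "Poly_Mapping.keys a \<union> Poly_Mapping.keys b"
  have "monomial_eval c x = (\<Prod>i\<in>?A. x i ^ Poly_Mapping.lookup c i)"
    if "Poly_Mapping.keys c \<subseteq> ?A" for c
    unfolding monomial_eval_def using that by (intro prod_keys_superset) auto
  then show ?thesis
    by (simp add: keys_add lookup_add prod.distrib power_add)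
qed

lemma mpoly_eval_conv: "mpoly_eval f x = (\<Sum>a\<in>Poly_Mapping.keys f. Poly_Mapping.lookup f a * monomial_eval a x)"
  by (simp add: mpoly_eval_def monomial_eval_def)

lemma mpoly_eval_single: "mpoly_eval (Poly_Mapping.single a c) x = c * monomial_eval a x"
  by (simp add: mpoly_eval_conv)

lemma mpoly_eval_0: "mpoly_eval 0 x = 0"
  by (simp add: mpoly_eval_conv)

lemma mpoly_eval_add: "mpoly_eval (f + g) x = mpoly_eval f x + mpoly_eval g x"
proof -
  let ?A = "Poly_Mapping.keys f \<union> Poly_Mapping.keys g"
  have "mpoly_eval h x = (\<Sum>a\<in>?A. Poly_Mapping.lookup h a * monomial_eval a x)"
    if "Poly_Mapping.keys h \<subseteq> ?A" for h
    unfolding mpoly_eval_conv using that by (intro sum_keys_superset) auto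
  then show ?thesis
    by (simp add: keys_add lookup_add sum.distrib distrib_right)
qed

lemma mpoly_eval_sum: "mpoly_eval (sum f A) x = (\<Sum>t\<in>A. mpoly_eval (f t) x)"
  by (induction A rule: infinite_finite_induct) (simp_all add: mpoly_eval_0 mpoly_eval_add)

text \<open>Writing both factors as sums of monomials reduces the claim to
  \<open>monomial_eval_add\<close>.\<close>

lemma mpoly_eval_mult: "mpoly_eval (f * g) x = mpoly_eval f x * mpoly_eval g x"
proof -
  have sum_monomials: "(\<Sum>a\<in>Poly_Mapping.keys h. Poly_Mapping.single a (Poly_Mapping.lookup h a)) = h" 
    for h :: "('i \<Rightarrow>\<^sub>0 nat) \<Rightarrow>\<^sub>0 'k::comm_ring_1"
    by (rule poly_mapping_eqI) (auto simp: lookup_sum lookup_single when_def in_keys_iff)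
  have "mpoly_eval (f * g) x = mpoly_eval ((\<Sum>a\<in>Poly_Mapping.keys f. Poly_Mapping.single a (Poly_Mapping.lookup f a))
      * (\<Sum>b\<in>Poly_Mapping.keys g. Poly_Mapping.single b (Poly_Mapping.lookup g b))) x"
    by (simp only: sum_monomials)
  also have "\<dots> = mpoly_eval f x * mpoly_eval g x"
    by (simp add: sum_product mpoly_eval_sum mult_single mpoly_eval_single monomial_eval_add
        mpoly_eval_conv[of f] mpoly_eval_conv[of g] mult_ac)
  finally show ?thesis .
qed

text \<open>Closed sets depend only on the values of polynomials, so functions are used. The degree
  is a parameter, unlike in \<open>homogeneous_in\<close>, because sums need equal degrees and
  products add them.\<close>

definition homogeneous_fun :: "'i set \<Rightarrow> nat \<Rightarrow> (('i \<Rightarrow> 'k::comm_ring_1) \<Rightarrow> 'k) \<Rightarrow> bool" where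
  "homogeneous_fun X d g \<longleftrightarrow>
     (\<exists>f. (\<forall>a\<in>Poly_Mapping.keys f. Poly_Mapping.keys a \<subseteq> X \<and> monomial_degree a = d) \<and> mpoly_eval f = g)"

lemma homogeneous_funD:
  assumes "homogeneous_fun X d g"
  obtains f where "homogeneous_in X f" "mpoly_eval f = g"
  using assms unfolding homogeneous_fun_def homogeneous_in_def monomial_degree_def by blast

lemma homogeneous_fun_const: "homogeneous_fun X 0 (\<lambda>x. c)"
  unfolding homogeneous_fun_def
  by (rule exI[of _ "Poly_Mapping.single 0 c"])
    (auto simp: fun_eq_iff mpoly_eval_single monomial_eval_def monomial_degree_def)

lemma homogeneous_fun_var: "i \<in> X \<Longrightarrow> homogeneous_fun X 1 (\<lambda>x. x i)"
  unfolding homogeneous_fun_def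
  by (rule exI[of _ "Poly_Mapping.single (Poly_Mapping.single i 1) 1"])
    (auto simp: mpoly_eval_single monomial_eval_def monomial_degree_def)

lemma homogeneous_fun_0: "homogeneous_fun X d (\<lambda>x. 0)"
  unfolding homogeneous_fun_def by (rule exI[of _ 0]) (auto simp: mpoly_eval_0)

lemma homogeneous_fun_add:
  assumes "homogeneous_fun X d g" "homogeneous_fun X d h"
  shows "homogeneous_fun X d (\<lambda>x. g x + h x)"
proof -
  from assms obtain f f' where f: "mpoly_eval f = g" "mpoly_eval f' = h"
    and deg: "\<forall>a\<in>Poly_Mapping.keys f. Poly_Mapping.keys a \<subseteq> X \<and> monomial_degree a = d"
      "\<forall>a\<in>Poly_Mapping.keys f'. Poly_Mapping.keys a \<subseteq> X \<and> monomial_degree a = d"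
    unfolding homogeneous_fun_def by blast
  have "mpoly_eval (f + f') = (\<lambda>x. g x + h x)"
    by (simp add: fun_eq_iff mpoly_eval_add f)
  moreover have "\<forall>a\<in>Poly_Mapping.keys (f + f'). Poly_Mapping.keys a \<subseteq> X \<and> monomial_degree a = d"
    using deg keys_add[of f f'] by blast
  ultimately show ?thesis unfolding homogeneous_fun_def by blast
qed

lemma homogeneous_fun_mult:
  assumes "homogeneous_fun X d g" "homogeneous_fun X e h"
  shows "homogeneous_fun X (d + e) (\<lambda>x. g x * h x)"
proof -
  from assms obtain f f' where f: "mpoly_eval f = g" "mpoly_eval f' = h"
    and deg: "\<forall>a\<in>Poly_Mapping.keys f. Poly_Mapping.keys a \<subseteq> X \<and> monomial_degree a = d"
      "\<forall>a\<in>Poly_Mapping.keys f'. Poly_Mapping.keys a \<subseteq> X \<and> monomial_degree a = e"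
    unfolding homogeneous_fun_def by blast
  have "mpoly_eval (f * f') = (\<lambda>x. g x * h x)"
    by (simp add: fun_eq_iff mpoly_eval_mult f)
  moreover have "Poly_Mapping.keys a \<subseteq> X \<and> monomial_degree a = d + e"
    if a: "a \<in> Poly_Mapping.keys (f * f')" for a
  proof -
    from a keys_mult[of f f'] obtain b c
      where "a = b + c" "b \<in> Poly_Mapping.keys f" "c \<in> Poly_Mapping.keys f'" by blast
    then show ?thesis
      using deg order_trans[OF keys_add[of b c], of X] by (simp add: monomial_degree_add)
  qed
  ultimately show ?thesis unfolding homogeneous_fun_def by blast
qed

lemma homogeneous_fun_cmult: "homogeneous_fun X d g \<Longrightarrow> homogeneous_fun X d (\<lambda>x. c * g x)"
  using homogeneous_fun_mult[OF homogeneous_fun_const] by simp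

lemma homogeneous_fun_sum:
  assumes "\<And>t. t \<in> A \<Longrightarrow> homogeneous_fun X d (g t)"
  shows "homogeneous_fun X d (\<lambda>x. \<Sum>t\<in>A. g t x)"
  using assms
  by (induction A rule: infinite_finite_induct) (simp_all add: homogeneous_fun_0 homogeneous_fun_add)

text \<open>An infinite \<open>A\<close> is covered: the product is then \<open>1\<close> and
  \<open>card A\<close> is \<open>0\<close>.\<close>

lemma homogeneous_fun_prod:
  assumes "\<And>t. t \<in> A \<Longrightarrow> homogeneous_fun X d (g t)"
  shows "homogeneous_fun X (card A * d) (\<lambda>x. \<Prod>t\<in>A. g t x)"
  using assms
  by (induction A rule: infinite_finite_induct)
    (simp_all add: homogeneous_fun_const homogeneous_fun_mult)

text \<open>Each product in the Leibniz expansion has \<open>n\<close> factors of degree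
  \<open>d\<close>.\<close>

lemma homogeneous_fun_det:
  assumes "\<And>a b. a < n \<Longrightarrow> b < n \<Longrightarrow> homogeneous_fun X d (g a b)"
  shows "homogeneous_fun X (n * d) (\<lambda>x. det (mat n n (\<lambda>(a, b). g a b x)))"
proof -
  have prod: "homogeneous_fun X (n * d) (\<lambda>x. \<Prod>i = 0..<n. g i (p i) x)" if "p permutes {0..<n}" for p
    using homogeneous_fun_prod[of "{0..<n}" X d "\<lambda>i. g i (p i)"] assms permutes_in_image[OF that]
    by auto
  have "(\<lambda>x. det (mat n n (\<lambda>(a, b). g a b x))) =
      (\<lambda>x. \<Sum>p\<in>{p. p permutes {0..<n}}. signof p * (\<Prod>i = 0..<n. g i (p i) x))"
    by (rule ext, subst det_def'[of _ n])
      (auto intro!: sum.cong prod.cong arg_cong2[where f = "(*)"] dest: permutes_in_image)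
  then show ?thesis
    by (auto intro!: homogeneous_fun_sum homogeneous_fun_cmult prod)
qed

section \<open>Rank of a pairing\<close>

text \<open>Transposition turns a permutation of columns into one of rows.\<close>

lemma det_select_columns:
  fixes G :: "nat \<Rightarrow> nat \<Rightarrow> 'k::comm_ring_1"
  assumes p: "p permutes {0..<n}"
  shows "det (mat n n (\<lambda>(a, b). G a (p b))) = signof p * det (mat n n (\<lambda>(a, b). G a b))"
proof -
  let ?A = "mat n n (\<lambda>(b, a). G a b)"
  have "det (mat n n (\<lambda>(a, b). G a (p b))) = det (mat n n (\<lambda>(a, b). G a (p b)))\<^sup>T"
    by (rule det_transpose[symmetric, of _ n]) simp
  also have "(mat n n (\<lambda>(a, b). G a (p b)))\<^sup>T = mat n n (\<lambda>(b, a). ?A $$ (p b, a))"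
    using permutes_in_image[OF p] by (intro eq_matI) auto
  also have "det \<dots> = signof p * det ?A"
    by (rule det_permute_rows) (use p in auto)
  also have "det ?A = det ?A\<^sup>T"
    by (rule det_transpose[symmetric, of _ n]) simp
  also have "?A\<^sup>T = mat n n (\<lambda>(a, b). G a b)"
    by (intro eq_matI) auto
  finally show ?thesis .
qed

text \<open>Two enumerations of the same set of columns differ by a permutation. It depends on
  \<open>c\<close> and \<open>c'\<close> only, so the sign is the same for every
  \<open>G\<close>.\<close>

lemma det_reindex_columns:
  fixes c c' :: "nat \<Rightarrow> nat"
  assumes "inj_on c {0..<n}" "inj_on c' {0..<n}" "c ` {0..<n} = c' ` {0..<n}"
  shows "\<exists>p. p permutes {0..<n} \<and> (\<forall>G :: nat \<Rightarrow> nat \<Rightarrow> 'k::comm_ring_1.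
      det (mat n n (\<lambda>(a, b). G a (c b))) = signof p * det (mat n n (\<lambda>(a, b). G a (c' b))))"
proof -
  have "bij_betw c {0..<n} (c ` {0..<n})" "bij_betw c' {0..<n} (c ` {0..<n})"
    using assms by (auto simp: bij_betw_def)
  then have "bij_betw (inv_into {0..<n} c' \<circ> c) {0..<n} {0..<n}"
    using bij_betw_inv_into bij_betw_trans by blast
  \<comment> \<open>Outside the index range \<open>p\<close> is the identity, as
    \<open>permutes\<close> demands.\<close>
  define p where "p i = (if i \<in> {0..<n} then (inv_into {0..<n} c' \<circ> c) i else i)" for i
  have "bij_betw p {0..<n} {0..<n}"
    using \<open>bij_betw (inv_into {0..<n} c' \<circ> c) {0..<n} {0..<n}\<close>
    by (rule bij_betw_cong[THEN iffD1, rotated]) (simp add: p_def)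
  then have p: "p permutes {0..<n}"
    by (rule bij_imp_permutes) (simp add: p_def)
  have c: "c b = c' (p b)" if "b < n" for b
  proof -
    have "c b \<in> c' ` {0..<n}" using that assms(3) by auto
    then show ?thesis using that by (simp add: p_def f_inv_into_f)
  qed
  have "mat n n (\<lambda>(a, b). G a (c b)) = mat n n (\<lambda>(a, b). G a (c' (p b)))" for G :: "nat \<Rightarrow> nat \<Rightarrow> 'k"
    by (intro eq_matI) (auto simp: c)
  then have "det (mat n n (\<lambda>(a, b). G a (c b))) = signof p * det (mat n n (\<lambda>(a, b). G a (c' b)))"
    for G :: "nat \<Rightarrow> nat \<Rightarrow> 'k"
    by (simp only: det_select_columns[OF p, of "\<lambda>a b. G a (c' b)"])
  with p show ?thesis by blast
qed

lemma det_not_inj_columns: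
  fixes G :: "nat \<Rightarrow> nat \<Rightarrow> 'k::comm_ring_1"
  assumes "\<not> inj_on c {0..<n}"
  shows "det (mat n n (\<lambda>(a, b). G a (c b))) = 0"
proof -
  from assms obtain i j where "i < n" "j < n" "i \<noteq> j" "c i = c j"
    by (auto simp: inj_on_def)
  then show ?thesis
    by (intro det_identical_columns[of _ n i j]) (auto intro!: eq_vecI)
qed

section \<open>Dimension bounds from determinants of pairings\<close>

context vector_space
begin

text \<open>Passes from a finite spanning set, the form in which finite dimension is assumed, to the
  basis that the locale \<open>finite_dimensional_vector_space\<close> carries.\<close>

lemma finite_dimensional_of_spanning:
  assumes "finite B" "span B = UNIV"
  obtains B' where "finite_dimensional_vector_space scale B'"
proof -
  obtain B' where B': "B' \<subseteq> B" "independent B'" "B \<subseteq> span B'"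
    by (rule maximal_independent_subset)
  moreover have "span B' = UNIV"
    using span_minimal[OF B'(3) subspace_span] assms(2) by auto
  ultimately have "finite_dimensional_vector_space scale B'"
    using assms finite_subset by unfold_locales auto
  then show ?thesis by (rule that)
qed

lemma dim_mono_of_spanning:
  assumes "finite B" "span B = UNIV" "S \<subseteq> T"
  shows "dim S \<le> dim T"
proof -
  obtain B' where "finite_dimensional_vector_space scale B'"
    using finite_dimensional_of_spanning[OF assms(1,2)] .
  then interpret finite_dimensional_vector_space scale B' .
  show ?thesis using assms(3) by (rule dim_subset)
qed

text \<open>A nonsingular pairing with functionals that vanish on \<open>K\<close> makes the
  \<open>y b\<close> independent modulo \<open>K\<close>, so their span and \<open>K\<close> form a
  direct sum inside \<open>W\<close>.\<close>

lemma det_pairing_dim: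
  assumes fin: "finite B" "span B = UNIV"
    and Y: "subspace W" "\<And>b. b < d \<Longrightarrow> y b \<in> W"
    and lin: "\<And>a. a < d \<Longrightarrow> Vector_Spaces.linear scale (*) (\<psi> a)"
    and K: "subspace K" "K \<subseteq> W" "\<And>a w. a < d \<Longrightarrow> w \<in> K \<Longrightarrow> \<psi> a w = 0"
    and det: "det (mat d d (\<lambda>(a, b). \<psi> a (y b))) \<noteq> 0"
  shows "d + dim K \<le> dim W"
proof -
  obtain B' where "finite_dimensional_vector_space scale B'"
    using finite_dimensional_of_spanning[OF fin] .
  then interpret finite_dimensional_vector_space scale B' .
  let ?A = "mat d d (\<lambda>(a, b). \<psi> a (y b))"
  \<comment> \<open>If the combination lies in \<open>K\<close>, every \<open>\<psi> a\<close> kills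
    it, so \<open>?A\<close> maps its coefficient vector to zero.\<close>
  have zero: "\<forall>b<d. c b = 0" if "(\<Sum>b<d. c b *s y b) \<in> K" for c
  proof -
    let ?v = "vec d c"
    have "?A *\<^sub>v ?v = 0\<^sub>v d"
    proof (intro eq_vecI)
      fix a assume "a < dim_vec (0\<^sub>v d)"
      then have a: "a < d" by simp
      interpret l: Vector_Spaces.linear scale "(*)" "\<psi> a" by (rule lin[OF a])
      have "(?A *\<^sub>v ?v) $ a = (\<Sum>b<d. \<psi> a (y b) * c b)"
        using a by (simp add: scalar_prod_def lessThan_atLeast0)
      also have "\<dots> = \<psi> a (\<Sum>b<d. c b *s y b)"
        by (simp add: l.sum l.scale mult.commute)
      also have "\<dots> = 0" using K(3)[OF a that] .
      finally show "(?A *\<^sub>v ?v) $ a = 0\<^sub>v d $ a" using a by simp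
    qed simp
    then have "?v = 0\<^sub>v d"
      using det det_0_iff_vec_prod_zero[of ?A d] by (metis mat_carrier vec_carrier)
    then show ?thesis by (metis index_vec index_zero_vec(1))
  qed
  have inj: "inj_on y {..<d}"
  proof (rule inj_onI)
    fix i k assume ik: "i \<in> {..<d}" "k \<in> {..<d}" "y i = y k"
    show "i = k"
    proof (rule ccontr)
      assume "i \<noteq> k"
      \<comment> \<open>The relation \<open>y i - y k = 0\<close> with coefficients \<open>1\<close>
        and \<open>-1\<close> would contradict \<open>zero\<close>.\<close>
      let ?c = "\<lambda>b. if b = i then 1 else if b = k then - 1 else (0::'a)"
      have "(\<Sum>b<d. ?c b *s y b) = (\<Sum>b\<in>{i, k}. ?c b *s y b)"
        using ik by (intro sum.mono_neutral_right) auto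
      also have "\<dots> = 0" using ik \<open>i \<noteq> k\<close> by simp
      finally have "(\<Sum>b<d. ?c b *s y b) \<in> K" using subspace_0[OF K(1)] by (simp only:)
      then have "\<forall>b<d. ?c b = 0" by (rule zero[of ?c])
      then have "?c i = 0" using ik by blast
      then show False by simp
    qed
  qed
  have comb: "\<exists>c. w = (\<Sum>b<d. c b *s y b)" if "w \<in> span (y ` {..<d})" for w
    using that
  proof (induction rule: span_induct_alt)
    case base
    show ?case by (rule exI[of _ "\<lambda>_. 0"]) simp
  next
    case (step c x w)
    then obtain k f where k: "k < d" "x = y k" and f: "w = (\<Sum>b<d. f b *s y b)" by auto
    have "c *s x = (\<Sum>b<d. (if b = k then c else 0) *s y b)"
      using k by (simp add: if_distrib[of "\<lambda>t. t *s _"] cong: if_cong)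
    then show ?case
      by (intro exI[of _ "\<lambda>b. (if b = k then c else 0) + f b"]) (simp add: f scale_left_distrib sum.distrib)
  qed
  have "independent (y ` {..<d})"
    unfolding dependent_finite[OF finite_imageI[OF finite_lessThan]]
  proof (intro notI, elim exE conjE bexE)
    fix u v assume v: "v \<in> y ` {..<d}" "u v \<noteq> 0" and "(\<Sum>v\<in>y ` {..<d}. u v *s v) = 0"
    then have "(\<Sum>b<d. u (y b) *s y b) = 0" by (simp add: sum.reindex[OF inj])
    then have "\<forall>b<d. u (y b) = 0" using zero[of "u \<circ> y"] subspace_0[OF K(1)] by simp
    then show False using v by auto
  qed
  then have dimS: "dim (y ` {..<d}) = d"
    by (simp add: dim_eq_card_independent card_image[OF inj])
  \<comment> \<open>A common element is a combination of the \<open>y b\<close> lying in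
    \<open>K\<close>, so by \<open>zero\<close> its coefficients vanish.\<close>
  have int: "span (y ` {..<d}) \<inter> K = {0}"
    using comb zero subspace_0[OF K(1)] span_zero by fastforce
  have "d + dim K = dim {x + z |x z. x \<in> span (y ` {..<d}) \<and> z \<in> K}"
    using dim_sums_Int[OF subspace_span K(1), of "y ` {..<d}"] int by (simp add: dimS)
  also have "\<dots> \<le> dim W"
  proof (rule dim_subset)
    have "span (y ` {..<d}) \<subseteq> W" using Y by (intro span_minimal) auto
    then show "{x + z |x z. x \<in> span (y ` {..<d}) \<and> z \<in> K} \<subseteq> W"
      using K(2) subspace_add[OF Y(1)] by blast
  qed
  finally show ?thesis .
qed

text \<open>
  The inductive step borders a nonsingular block by one more row and column: expanding along the
  new row shows that if all bordered determinants vanish, then every element of \<open>Y\<close> is a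
  combination of the \<open>y b\<close> modulo the common kernel.
\<close>
lemma det_pairing_exists:
  assumes fin: "finite B" "span B = UNIV"
    and lin: "\<And>f. f \<in> \<Psi> \<Longrightarrow> Vector_Spaces.linear scale (*) f"
    and d: "d + dim {w \<in> span Y. \<forall>f\<in>\<Psi>. f w = 0} \<le> dim (span Y)"
  shows "\<exists>y \<psi>. (\<forall>b<d. y b \<in> Y) \<and> (\<forall>a<d. \<psi> a \<in> \<Psi>) \<and> det (mat d d (\<lambda>(a, b). \<psi> a (y b))) \<noteq> 0"
  using d
proof (induction d)
  case 0
  show ?case by (simp add: det_dim_zero)
next
  case (Suc d)
  define K where "K = {w \<in> span Y. \<forall>f\<in>\<Psi>. f w = 0}"
  obtain y \<psi> where y: "\<And>b. b < d \<Longrightarrow> y b \<in> Y" and \<psi>: "\<And>a. a < d \<Longrightarrow> \<psi> a \<in> \<Psi>"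
    and det: "det (mat d d (\<lambda>(a, b). \<psi> a (y b))) \<noteq> 0"
    using Suc by auto
  show ?case
  proof (rule ccontr)
    assume neg: "\<not> ?case"
    have "z \<in> span (K \<union> y ` {..<d})" if z: "z \<in> Y" for z
    proof -
      \<comment> \<open>The border has \<open>z\<close> as new column and a varying functional
        \<open>f\<close> as new row.\<close>
      define y' where "y' = y(d := z)"
      define M where "M f = mat (Suc d) (Suc d) (\<lambda>(a, b). (\<psi>(d := f)) a (y' b))" for f
      \<comment> \<open>Cofactors along row \<open>d\<close> do not involve that row, so
        \<open>\<psi> 0\<close> is only a placeholder for \<open>f\<close>.\<close>
      define q where "q b = cofactor (M (\<psi> 0)) d b" for b
      have q: "cofactor (M f) d b = q b" for f b
        unfolding q_def cofactor_def mat_delete_def M_def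
        by (intro arg_cong2[where f = "(*)"] refl arg_cong[where f = det] eq_matI) auto
      have qd: "q d = det (mat d d (\<lambda>(a, b). \<psi> a (y b)))"
        unfolding q_def cofactor_def mat_delete_def M_def
        by (auto intro!: arg_cong[where f = det] eq_matI simp: y'_def)
      \<comment> \<open>Expanding \<open>det (M f)\<close> along row \<open>d\<close> identifies it
        with the value of \<open>f\<close> at this combination, and it vanishes by
        \<open>neg\<close>.\<close>
      have "(\<Sum>b<Suc d. q b *s y' b) \<in> K"
        unfolding K_def
      proof (intro CollectI conjI ballI)
        show "(\<Sum>b<Suc d. q b *s y' b) \<in> span Y"
          using y z by (intro span_sum span_scale span_base) (auto simp: y'_def)
        fix f assume f: "f \<in> \<Psi>"
        interpret l: Vector_Spaces.linear scale "(*)" f by (rule lin[OF f])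
        have "det (M f) = 0"
        proof (rule ccontr)
          assume "det (M f) \<noteq> 0"
          moreover have "\<forall>b<Suc d. y' b \<in> Y" "\<forall>a<Suc d. (\<psi>(d := f)) a \<in> \<Psi>"
            using y \<psi> z f by (auto simp: y'_def)
          ultimately show False using neg unfolding M_def by blast
        qed
        moreover have "det (M f) = (\<Sum>b<Suc d. M f $$ (d, b) * cofactor (M f) d b)"
          by (rule laplace_expansion_row) (auto simp: M_def)
        moreover have "\<dots> = (\<Sum>b<Suc d. q b * f (y' b))"
          unfolding q by (intro sum.cong) (simp_all add: M_def mult.commute)
        ultimately show "f (\<Sum>b<Suc d. q b *s y' b) = 0"
          by (simp add: l.sum l.scale l.add)
      qed
      moreover have "(\<Sum>b<Suc d. q b *s y' b) = (\<Sum>b<d. q b *s y b) + q d *s z"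
        by (simp add: y'_def)
      \<comment> \<open>\<open>q d\<close> is the old determinant; being nonzero, it can be divided
        out to express \<open>z\<close>.\<close>
      ultimately obtain k where "k \<in> K" and k: "q d *s z = k - (\<Sum>b<d. q b *s y b)"
        by (metis add_diff_cancel_left')
      have "k - (\<Sum>b<d. q b *s y b) \<in> span (K \<union> y ` {..<d})"
        using \<open>k \<in> K\<close> by (intro span_diff span_sum span_scale span_base) auto
      then have "(1 / q d) *s (q d *s z) \<in> span (K \<union> y ` {..<d})"
        unfolding k by (rule span_scale)
      then show ?thesis using det qd by simp
    qed
    then have le: "span Y \<subseteq> span (K \<union> y ` {..<d})"
      by (intro span_minimal) auto
    \<comment> \<open>A basis of \<open>K\<close> and the \<open>d\<close> vectors
      \<open>y b\<close> together span \<open>Y\<close>, so \<open>dim (span Y)\<close> is at most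
      \<open>dim K + d\<close>, one too few.\<close>
    obtain C where C: "C \<subseteq> K" "independent C" "K \<subseteq> span C" "card C = dim K"
      by (rule basis_exists)
    have finC: "finite C"
      using independent_span_bound[OF fin(1) C(2)] fin(2) by auto
    have "K \<union> y ` {..<d} \<subseteq> span (C \<union> y ` {..<d})"
      using C(3) span_mono[OF Un_upper1, of C "y ` {..<d}"] span_superset[of "C \<union> y ` {..<d}"] by blast
    then have "span Y \<subseteq> span (C \<union> y ` {..<d})"
      using le span_minimal[OF _ subspace_span] by blast
    then have "dim (span Y) \<le> card (C \<union> y ` {..<d})"
      using finC by (intro dim_le_card) auto
    also have "\<dots> \<le> dim K + d"
      using card_Un_le[of C "y ` {..<d}"] card_image_le[of "{..<d}" y] C(4) by simp
    finally show False using Suc.prems by (simp add: K_def)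
  qed
qed

end

section \<open>Pluecker coordinates and generators of a subspace\<close>

context vector_space
begin

lemma ordered_basis_expand:
  assumes "ordered_basis scale vs V" "u \<in> V"
  shows "(\<Sum>l<length vs. representation (set vs) u (vs ! l) *s vs ! l) = u"
proof -
  have vs: "distinct vs" "independent (set vs)" "span (set vs) = V"
    using assms(1) by (simp_all add: ordered_basis_def)
  have "(\<Sum>l<length vs. representation (set vs) u (vs ! l) *s vs ! l) = (\<Sum>v\<in>set vs. representation (set vs) u v *s v)"
    using bij_betw_nth[OF vs(1) refl refl] by (rule sum.reindex_bij_betw)
  also have "\<dots> = u"
    using assms(2) vs by (intro sum_representation_eq) auto
  finally show ?thesis .
qed

lemma ordered_basis_length:
  assumes "ordered_basis scale us U"
  shows "length us = dim U"
  using assms dim_eq_card_independent[of "set us"] distinct_card[of us] by (auto simp: ordered_basis_def)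

lemma ordered_basis_exists:
  assumes "finite B" "span B = UNIV" "subspace U"
  obtains us where "ordered_basis scale us U"
proof -
  obtain C where C: "C \<subseteq> U" "independent C" "U \<subseteq> span C"
    using basis_exists by metis
  then have "finite C" "span C = U"
    using independent_span_bound[OF assms(1) C(2)] assms span_minimal[of C U] by auto
  then show ?thesis
    using that finite_distinct_list[of C] C(2) by (auto simp: ordered_basis_def)
qed

text \<open>The coordinate functions have no common zero in \<open>U\<close> except
  \<open>0\<close>, so \<open>det_pairing_exists\<close> yields a nonsingular block of full size
  \<open>length us\<close>.\<close>

lemma nonzero_maximal_minor:
  assumes fin: "finite B" "span B = UNIV"
    and vs: "ordered_basis scale vs V" and us: "ordered_basis scale us U" and "U \<subseteq> V"
  shows "\<exists>c. (\<forall>i<length us. c i < length vs) \<and>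
    det (mat (length us) (length us) (\<lambda>(a, b). representation (set vs) (us ! a) (vs ! c b))) \<noteq> 0"
proof -
  let ?r = "length us"
  \<comment> \<open>\<open>representation (set vs)\<close> is zero outside \<open>V\<close> and may
    fail to be linear on the whole space, so coordinates are taken in a basis extending
    \<open>vs\<close>; the two agree on \<open>V\<close>.\<close>
  let ?E = "extend_basis (set vs)"
  define R where "R i l = representation (set vs) (us ! i) (vs ! l)" for i l
  have ind: "independent (set vs)" and V: "span (set vs) = V" and U: "span (set us) = U"
    using vs us by (auto simp: ordered_basis_def)
  have rep: "representation ?E w = representation (set vs) w" if "w \<in> V" for w
    using that V by (intro representation_extend independent_extend_basis extend_basis_superset ind) auto
  let ?\<Psi> = "(\<lambda>l w. representation ?E w (vs ! l)) ` {..<length vs}"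
  have "{w \<in> span (set us). \<forall>f\<in>?\<Psi>. f w = 0} \<subseteq> span {}"
  proof
    fix w assume w: "w \<in> {w \<in> span (set us). \<forall>f\<in>?\<Psi>. f w = 0}"
    then have "w \<in> V" using U \<open>U \<subseteq> V\<close> by auto
    with w have "\<forall>l<length vs. representation (set vs) w (vs ! l) = 0" by (auto simp: rep)
    then have "w = 0" using ordered_basis_expand[OF vs \<open>w \<in> V\<close>] by simp
    then show "w \<in> span {}" by simp
  qed
  then have "dim {w \<in> span (set us). \<forall>f\<in>?\<Psi>. f w = 0} = 0"
    using dim_le_card[of _ "{}"] by fastforce
  then have "?r + dim {w \<in> span (set us). \<forall>f\<in>?\<Psi>. f w = 0} \<le> dim (span (set us))"
    using ordered_basis_length[OF us] U by simp
  moreover have "Vector_Spaces.linear scale (*) f" if "f \<in> ?\<Psi>" for f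
    using that by (auto intro!: linear_representation independent_extend_basis span_extend_basis ind)
  ultimately obtain y \<psi> where y: "\<forall>b<?r. y b \<in> set us" and \<psi>: "\<forall>a<?r. \<psi> a \<in> ?\<Psi>"
    and det: "det (mat ?r ?r (\<lambda>(a, b). \<psi> a (y b))) \<noteq> 0"
    using det_pairing_exists[OF fin, of ?\<Psi> ?r "set us"] by blast
  have "\<forall>b. \<exists>i. b < ?r \<longrightarrow> i < ?r \<and> us ! i = y b"
    using y by (simp add: in_set_conv_nth)
  then obtain s where s: "\<And>b. b < ?r \<Longrightarrow> s b < ?r" "\<And>b. b < ?r \<Longrightarrow> us ! s b = y b"
    by metis
  have "\<forall>a. \<exists>l. a < ?r \<longrightarrow> l < length vs \<and> \<psi> a = (\<lambda>w. representation ?E w (vs ! l))"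
    using \<psi> by blast
  then obtain c where c: "\<And>a. a < ?r \<Longrightarrow> c a < length vs"
    "\<And>a. a < ?r \<Longrightarrow> \<psi> a = (\<lambda>w. representation ?E w (vs ! c a))"
    by metis
  have usV: "us ! i \<in> V" if "i < ?r" for i
    using that U \<open>U \<subseteq> V\<close> span_base[of "us ! i" "set us"] by auto
  have "mat ?r ?r (\<lambda>(a, b). \<psi> a (y b)) = mat ?r ?r (\<lambda>(a, b). R (s b) (c a))"
    using usV by (intro eq_matI) (auto simp: R_def c rep s(1) simp flip: s(2))
  then have det': "det (mat ?r ?r (\<lambda>(a, b). R (s b) (c a))) \<noteq> 0"
    using det by simp
  \<comment> \<open>A repeated index would give two equal columns. An injective \<open>s\<close>
    merely permutes \<open>us\<close>, which changes only the sign.\<close>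
  then have inj: "inj_on s {0..<?r}"
    using det_not_inj_columns[of s ?r "\<lambda>a b. R b (c a)"] by blast
  then have "s ` {0..<?r} = id ` {0..<?r}"
    using endo_inj_surj[of "{0..<?r}" s] by (simp add: image_subset_iff s(1))
  then obtain p where p: "\<And>G :: nat \<Rightarrow> nat \<Rightarrow> 'a. det (mat ?r ?r (\<lambda>(a, b). G a (s b))) =
      signof p * det (mat ?r ?r (\<lambda>(a, b). G a (id b)))"
    using det_reindex_columns[OF inj inj_on_id] by blast
  from p[of "\<lambda>a b. R b (c a)"] det' have "det (mat ?r ?r (\<lambda>(a, b). R b (c a))) \<noteq> 0"
    by auto
  moreover have "(mat ?r ?r (\<lambda>(a, b). R a (c b)))\<^sup>T = mat ?r ?r (\<lambda>(a, b). R b (c a))"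
    by (intro eq_matI) auto
  ultimately have "det (mat ?r ?r (\<lambda>(a, b). R a (c b))) \<noteq> 0"
    using det_transpose[of "mat ?r ?r (\<lambda>(a, b). R a (c b))" ?r] by simp
  then show ?thesis using c(1) by (auto simp: R_def)
qed

text \<open>An injective \<open>c\<close> enumerates an \<open>r\<close>-subset, and sorting it
  costs a sign that depends on \<open>c\<close> only. Repeated columns give the zero function; they
  must be allowed because Cramer's rule puts an arbitrary column in place of a selected one.\<close>

lemma minor_eq_pluecker:
  assumes c: "\<And>i. i < r \<Longrightarrow> c i < length vs"
  shows "\<exists>e. homogeneous_fun {I. I \<subseteq> {..<length vs} \<and> card I = r} 1 e \<and>
    (\<forall>us. length us = r \<longrightarrow>
      det (mat r r (\<lambda>(a, b). representation (set vs) (us ! a) (vs ! c b))) = e (pluecker scale vs us))"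
proof (cases "inj_on c {0..<r}")
  case False
  show ?thesis
  proof (intro exI[of _ "\<lambda>x. 0"] conjI allI impI)
    show "homogeneous_fun {I. I \<subseteq> {..<length vs} \<and> card I = r} 1 (\<lambda>x. 0)"
      by (rule homogeneous_fun_0)
    show "det (mat r r (\<lambda>(a, b). representation (set vs) (us ! a) (vs ! c b))) = 0" for us
      using det_not_inj_columns[OF False, of "\<lambda>a l. representation (set vs) (us ! a) (vs ! l)"] by simp
  qed
next
  case True
  define I where "I = c ` {0..<r}"
  have card: "card I = r" using card_image[OF True] by (simp add: I_def)
  have I: "I \<subseteq> {..<length vs}" using c by (auto simp: I_def)
  have finI: "finite I" by (simp add: I_def)
  have inj: "inj_on (pick I) {0..<r}"
    by (rule inj_onI) (metis card atLeastLessThan_iff linorder_neqE_nat nat_less_le pick_mono)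
  have "pick I ` {0..<r} = I"
  proof (rule card_subset_eq[OF finI])
    show "pick I ` {0..<r} \<subseteq> I" using pick_in_set card by auto
    show "card (pick I ` {0..<r}) = card I" using card_image[OF inj] card by simp
  qed
  then have "c ` {0..<r} = pick I ` {0..<r}" by (simp add: I_def)
  then obtain p where p: "\<And>G :: nat \<Rightarrow> nat \<Rightarrow> 'a. det (mat r r (\<lambda>(a, b). G a (c b))) =
      signof p * det (mat r r (\<lambda>(a, b). G a (pick I b)))"
    using det_reindex_columns[OF True inj] by blast
  show ?thesis
  proof (intro exI[of _ "\<lambda>x. signof p * x I"] conjI allI impI)
    show "homogeneous_fun {I. I \<subseteq> {..<length vs} \<and> card I = r} 1 (\<lambda>x. signof p * x I)"
      using I card by (intro homogeneous_fun_cmult homogeneous_fun_var) auto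
    fix us :: "'b list" assume len: "length us = r"
    have "{l. l < length vs \<and> l \<in> I} = I" using I by auto
    \<comment> \<open>The columns of \<open>submatrix\<close> follow the increasing order of
      \<open>I\<close>, so column \<open>b\<close> is the one numbered
      \<open>pick I b\<close>.\<close>
    then have "submatrix (mat (length us) (length vs)
        (\<lambda>(i, l). representation (set vs) (us ! i) (vs ! l))) UNIV I =
        mat r r (\<lambda>(a, b). representation (set vs) (us ! a) (vs ! pick I b))"
      using card I pick_in_set[of _ I]
      by (intro eq_matI) (auto simp: submatrix_def len pick_UNIV subset_iff)
    then show "det (mat r r (\<lambda>(a, b). representation (set vs) (us ! a) (vs ! c b))) =
        signof p * pluecker scale vs us I"
      using p[of "\<lambda>a l. representation (set vs) (us ! a) (vs ! l)"]
      by (simp add: pluecker_def)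
  qed
qed

text \<open>
  For a choice \<open>c\<close> of \<open>r\<close> columns of the coordinate matrix \<open>A\<close> of a basis of \<open>U\<close>, these vectors are the
  rows of \<open>adj(A\<^sub>c) A\<close>.  By Cramer's rule their coordinates are maximal minors of \<open>A\<close>.
\<close>
lemma pluecker_generators:
  assumes fin: "finite B" "span B = UNIV"
    and vs: "ordered_basis scale vs V"
  obtains h :: "(nat \<Rightarrow> nat) \<Rightarrow> nat \<Rightarrow> nat \<Rightarrow> (nat set \<Rightarrow> 'a) \<Rightarrow> 'a"
  where "\<And>c i l. (\<And>b. b < r \<Longrightarrow> c b < length vs) \<Longrightarrow> l < length vs \<Longrightarrow>
      homogeneous_fun {I. I \<subseteq> {..<length vs} \<and> card I = r} 1 (h c i l)"
    and "\<And>c i us U. (\<And>b. b < r \<Longrightarrow> c b < length vs) \<Longrightarrow> i < r \<Longrightarrow>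
      ordered_basis scale us U \<Longrightarrow> U \<subseteq> V \<Longrightarrow> dim U = r \<Longrightarrow>
      (\<Sum>l<length vs. h c i l (pluecker scale vs us) *s vs ! l) \<in> U"
    and "\<And>us U. ordered_basis scale us U \<Longrightarrow> U \<subseteq> V \<Longrightarrow> dim U = r \<Longrightarrow>
      \<exists>c. (\<forall>b<r. c b < length vs) \<and>
        U \<subseteq> span ((\<lambda>i. \<Sum>l<length vs. h c i l (pluecker scale vs us) *s vs ! l) ` {..<r})"
proof -
  let ?X = "{I. I \<subseteq> {..<length vs} \<and> card I = r}"
  define R where "R us a l = representation (set vs) (us ! a) (vs ! l)" for us a l
  let ?C = "{c. \<forall>b<r. c b < length vs}"
  have "\<forall>c\<in>?C. \<exists>e. homogeneous_fun ?X 1 e \<and>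
      (\<forall>us. length us = r \<longrightarrow> det (mat r r (\<lambda>(a, b). R us a (c b))) = e (pluecker scale vs us))"
    unfolding R_def by (intro ballI minor_eq_pluecker) simp
  \<comment> \<open>The function \<open>e c\<close> is fixed before any \<open>us\<close>, so it
    serves all subspaces at once.\<close>
  from bchoice[OF this] obtain e where e_choice: "\<forall>c\<in>?C. homogeneous_fun ?X 1 (e c) \<and>
      (\<forall>us. length us = r \<longrightarrow> det (mat r r (\<lambda>(a, b). R us a (c b))) = e c (pluecker scale vs us))"
    by blast
  have e: "homogeneous_fun ?X 1 (e c)" if "\<forall>b<r. c b < length vs" for c
    using e_choice that by blast
  have e_eq: "e c (pluecker scale vs us) = det (mat r r (\<lambda>(a, b). R us a (c b)))"
    if "\<forall>b<r. c b < length vs" "length us = r" for c us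
    using e_choice that by simp
  \<comment> \<open>Replacing the \<open>i\<close>-th selected column by column \<open>l\<close>
    gives the entry \<open>(i, l)\<close> of \<open>adj(A\<^sub>c) A\<close>, by Cramer's
    rule.\<close>
  define h where "h c i l = e (c(i := l))" for c :: "nat \<Rightarrow> nat" and i l :: nat
  define q where "q us c i a = cofactor (mat r r (\<lambda>(a, b). R us a (c b))) a i" for us c i a
  have gen: "(\<Sum>l<length vs. h c i l (pluecker scale vs us) *s vs ! l) = (\<Sum>a<r. q us c i a *s us ! a)"
    if c: "\<And>b. b < r \<Longrightarrow> c b < length vs" and i: "i < r"
      and us: "ordered_basis scale us U" "U \<subseteq> V" "length us = r" for c i us U
  proof -
    have "h c i l (pluecker scale vs us) = (\<Sum>a<r. q us c i a * R us a l)" if l: "l < length vs" for l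
    proof -
      let ?M = "mat r r (\<lambda>(a, b). R us a ((c(i := l)) b))"
      have "h c i l (pluecker scale vs us) = det ?M"
        unfolding h_def using c l us(3) by (intro e_eq) auto
      \<comment> \<open>Expansion along the replaced column \<open>i\<close>, whose cofactors are
        those of the unmodified matrix.\<close>
      also have "\<dots> = (\<Sum>a<r. ?M $$ (a, i) * cofactor ?M a i)"
        by (rule laplace_expansion_column) (use i in auto)
      also have "\<dots> = (\<Sum>a<r. q us c i a * R us a l)"
      proof (intro sum.cong refl)
        fix a assume "a \<in> {..<r}"
        moreover have "cofactor ?M a i = q us c i a"
          unfolding q_def cofactor_def mat_delete_def
          by (intro arg_cong2[where f = "(*)"] refl arg_cong[where f = det] eq_matI) auto
        ultimately show "?M $$ (a, i) * cofactor ?M a i = q us c i a * R us a l"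
          using i by (simp add: mult.commute)
      qed
      finally show ?thesis .
    qed
    then have "(\<Sum>l<length vs. h c i l (pluecker scale vs us) *s vs ! l) =
        (\<Sum>l<length vs. \<Sum>a<r. q us c i a *s (R us a l *s vs ! l))"
      by (simp add: scale_sum_left)
    also have "\<dots> = (\<Sum>a<r. q us c i a *s (\<Sum>l<length vs. R us a l *s vs ! l))"
      by (subst sum.swap) (simp add: scale_sum_right)
    also have "\<dots> = (\<Sum>a<r. q us c i a *s us ! a)"
    proof (intro sum.cong refl arg_cong2[where f = scale])
      fix a assume "a \<in> {..<r}"
      then have "us ! a \<in> V"
        using us span_base[of "us ! a" "set us"] by (auto simp: ordered_basis_def)
      then show "(\<Sum>l<length vs. R us a l *s vs ! l) = us ! a"
        unfolding R_def by (rule ordered_basis_expand[OF vs])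
    qed
    finally show ?thesis .
  qed
  show ?thesis
  proof (rule that[of h])
    fix c i l assume "\<And>b. b < r \<Longrightarrow> c b < length vs" "l < length vs"
    then show "homogeneous_fun ?X 1 (h c i l)" unfolding h_def by (intro e) auto
  next
    fix c i us U
    assume c: "\<And>b. b < r \<Longrightarrow> c b < length vs" and i: "i < r"
      and us: "ordered_basis scale us U" "U \<subseteq> V" "dim U = r"
    have "length us = r" using ordered_basis_length us by simp
    moreover have "(\<Sum>a<r. q us c i a *s us ! a) \<in> span (set us)"
      using \<open>length us = r\<close> by (intro span_sum span_scale span_base) simp
    then have "(\<Sum>a<r. q us c i a *s us ! a) \<in> U"
      using us(1) by (simp add: ordered_basis_def)
    ultimately show "(\<Sum>l<length vs. h c i l (pluecker scale vs us) *s vs ! l) \<in> U"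
      using gen[OF c i us(1,2)] by simp
  next
    fix us U assume us: "ordered_basis scale us U" "U \<subseteq> V" "dim U = r"
    have len: "length us = r" using ordered_basis_length us by simp
    obtain c where c: "\<forall>b<r. c b < length vs"
      and det: "det (mat r r (\<lambda>(a, b). R us a (c b))) \<noteq> 0"
      using nonzero_maximal_minor[OF fin vs us(1,2)] unfolding R_def len by blast
    let ?M = "mat r r (\<lambda>(a, b). R us a (c b))"
    let ?w = "\<lambda>i. \<Sum>l<length vs. h c i l (pluecker scale vs us) *s vs ! l"
    have w: "?w i = (\<Sum>a<r. q us c i a *s us ! a)" if "i < r" for i
      using gen[OF _ that us(1,2) len] c by blast
    have "us ! b \<in> span (?w ` {..<r})" if b: "b < r" for b
    proof -
      \<comment> \<open>The product \<open>?M * adj_mat ?M\<close> is \<open>det ?M\<close> times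
        the identity, which recovers the basis of \<open>U\<close> from the \<open>?w i\<close> up
        to a nonzero factor.\<close>
      have adj: "(\<Sum>i<r. R us b (c i) * q us c i a) = (if b = a then det ?M else 0)" if a: "a < r" for a
      proof -
        have "(?M * adj_mat ?M) $$ (b, a) = (det ?M \<cdot>\<^sub>m 1\<^sub>m r) $$ (b, a)"
          using adj_mat(2)[of ?M r] by simp
        then show ?thesis
          using a b by (simp add: scalar_prod_def adj_mat_def q_def lessThan_atLeast0)
      qed
      have "(\<Sum>i<r. R us b (c i) *s ?w i) = (\<Sum>i<r. \<Sum>a<r. (R us b (c i) * q us c i a) *s us ! a)"
        by (simp add: w scale_sum_right)
      also have "\<dots> = (\<Sum>a<r. (if b = a then det ?M else 0) *s us ! a)"
        by (subst sum.swap) (simp add: adj flip: scale_sum_left)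
      also have "\<dots> = det ?M *s us ! b"
        using b by (simp add: if_distrib[of "\<lambda>t. t *s _"] cong: if_cong)
      finally have "us ! b = (1 / det ?M) *s (\<Sum>i<r. R us b (c i) *s ?w i)"
        using det by simp
      also have "\<dots> \<in> span (?w ` {..<r})"
        by (intro span_scale span_sum span_base) auto
      finally show ?thesis .
    qed
    then have "set us \<subseteq> span (?w ` {..<r})" using len by (auto simp: in_set_conv_nth)
    then have "U \<subseteq> span (?w ` {..<r})"
      using us(1) span_minimal[OF _ subspace_span] by (auto simp: ordered_basis_def)
    then show "\<exists>c. (\<forall>b<r. c b < length vs) \<and> U \<subseteq>
        span ((\<lambda>i. \<Sum>l<length vs. h c i l (pluecker scale vs us) *s vs ! l) ` {..<r})"
      using c by blast
  qed
qed

end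

section \<open>Rank loci on the Grassmannian\<close>

text \<open>Closedness can be checked with polynomial functions: the witness \<open>F\<close>
  collects every homogeneous polynomial whose evaluation lies in \<open>G\<close>.\<close>

lemma zariski_closed_GrassI:
  assumes vs: "ordered_basis kscale vs V"
    and hom: "\<And>g. g \<in> G \<Longrightarrow> homogeneous_fun {I. I \<subseteq> {..<length vs} \<and> card I = r} d g"
    and Z: "\<And>U. U \<in> Z \<Longrightarrow> U \<in> Grass r V"
      "\<And>U us g. U \<in> Z \<Longrightarrow> ordered_basis kscale us U \<Longrightarrow> g \<in> G \<Longrightarrow> g (pluecker kscale vs us) = 0"
      "\<And>U. U \<in> Grass r V \<Longrightarrow> (\<And>us g. ordered_basis kscale us U \<Longrightarrow> g \<in> G \<Longrightarrow> g (pluecker kscale vs us) = 0)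
        \<Longrightarrow> U \<in> Z"
  shows "zariski_closed_Grass r V Z"
proof -
  let ?X = "{I. I \<subseteq> {..<length vs} \<and> card I = r}"
  let ?F = "{f. homogeneous_in ?X f \<and> mpoly_eval f \<in> G}"
  have F: "\<exists>f\<in>?F. mpoly_eval f = g" if "g \<in> G" for g
    using hom[OF that] that by (auto elim!: homogeneous_funD)
  have "Z = {U \<in> Grass r V. \<forall>us. ordered_basis kscale us U \<longrightarrow>
               (\<forall>f\<in>?F. mpoly_eval f (pluecker kscale vs us) = 0)}"
    (is "Z = ?R")
  proof (intro equalityI subsetI)
    fix U assume "U \<in> Z"
    then show "U \<in> ?R" using Z(1,2) by auto
  next
    fix U assume U: "U \<in> ?R"
    show "U \<in> Z"
    proof (rule Z(3))
      show "U \<in> Grass r V" using U by simp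
      fix us g assume us: "ordered_basis kscale us U" and "g \<in> G"
      then obtain f where "f \<in> ?F" "mpoly_eval f = g" using F by blast
      then show "g (pluecker kscale vs us) = 0" using U us by auto
    qed
  qed
  then show ?thesis
    unfolding zariski_closed_Grass_def using vs by (intro exI[of _ vs] exI[of _ ?F]) auto
qed

section \<open>The group algebra and products acting on a module\<close>

lemma module_times: "Modules.module ((*) :: 'a::comm_ring_1 \<Rightarrow> 'a \<Rightarrow> 'a)"
  by unfold_locales (simp_all add: algebra_simps)

text \<open>The group elements span \<open>kE\<close>, and the group is finite.\<close>

lemma kscale_finite_spanning:
  "\<exists>B :: ('e::{comm_monoid_add, finite} \<Rightarrow>\<^sub>0 'k::field) set. finite B \<and> Modules.module.span kscale B = UNIV"
proof -
  interpret k: vector_space "kscale :: 'k \<Rightarrow> ('e \<Rightarrow>\<^sub>0 'k) \<Rightarrow> _"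
    by (rule vector_space_restrict_scalars) (rule module_times)
  let ?B = "range (\<lambda>g::'e. Poly_Mapping.single g (1::'k))"
  have "x \<in> k.span ?B" for x
  proof -
    have "(\<Sum>g\<in>UNIV. kscale (Poly_Mapping.lookup x g) (Poly_Mapping.single g 1)) = x"
      by (rule poly_mapping_eqI)
        (simp add: restrict_scalars_def mult_single lookup_sum lookup_single when_def)
    moreover have "(\<Sum>g\<in>UNIV. kscale (Poly_Mapping.lookup x g) (Poly_Mapping.single g 1)) \<in> k.span ?B"
      by (intro k.span_sum k.span_scale k.span_base) auto
    ultimately show ?thesis by simp
  qed
  then show ?thesis by (intro exI[of _ ?B]) auto
qed

lemma linear_act:
  assumes "Modules.module act"
  shows "Vector_Spaces.linear (restrict_scalars act) (restrict_scalars act) (act x)"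
proof -
  interpret Modules.module act by fact
  show ?thesis
    using vector_space_restrict_scalars[OF assms]
    by (intro Vector_Spaces.linear_iff[THEN iffD2] conjI)
      (simp_all add: restrict_scalars_def scale_right_distrib mult.commute)
qed

lemma linear_act_left:
  assumes "Modules.module act"
  shows "Vector_Spaces.linear kscale (restrict_scalars act) (\<lambda>x. act x m)"
proof -
  interpret Modules.module act by fact
  show ?thesis
    using vector_space_restrict_scalars[OF assms] vector_space_restrict_scalars[OF module_times]
    by (intro Vector_Spaces.linear_iff[THEN iffD2] conjI)
      (simp_all add: restrict_scalars_def scale_left_distrib)
qed

text \<open>Expanding the last factor linearly absorbs each \<open>v l\<close> into the vector
  \<open>m\<close> and leaves one coefficient of degree 1; hence \<open>m\<close> is arbitrary in
  the induction.\<close>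

lemma homogeneous_fun_act_prod:
  assumes act: "Modules.module act"
    and f: "Vector_Spaces.linear (restrict_scalars act) (*) f"
    and h: "\<And>i l. i < j \<Longrightarrow> l < N \<Longrightarrow> homogeneous_fun X 1 (h i l)"
  shows "homogeneous_fun X j (\<lambda>x. f (act (\<Prod>i<j. \<Sum>l<N. kscale (h i l x) (v l)) m))"
  using h
proof (induction j arbitrary: m)
  case 0
  show ?case by (simp add: homogeneous_fun_const)
next
  case (Suc j m)
  interpret Modules.module act by fact
  interpret f: Vector_Spaces.linear "restrict_scalars act" "(*)" f by fact
  interpret L: Vector_Spaces.linear "restrict_scalars act" "restrict_scalars act" "act z" for z
    by (rule linear_act[OF act])
  interpret R: Vector_Spaces.linear kscale "restrict_scalars act" "\<lambda>x. act x z" for z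
    by (rule linear_act_left[OF act])
  let ?P = "\<lambda>x. \<Prod>i<j. \<Sum>l<N. kscale (h i l x) (v l)"
  have "f (act (\<Prod>i<Suc j. \<Sum>l<N. kscale (h i l x) (v l)) m) =
      (\<Sum>l<N. f (act (?P x) (act (v l) m)) * h j l x)" for x
  proof -
    have "act (\<Prod>i<Suc j. \<Sum>l<N. kscale (h i l x) (v l)) m =
        act (?P x) (act (\<Sum>l<N. kscale (h j l x) (v l)) m)"
      by simp
    also have "\<dots> = (\<Sum>l<N. restrict_scalars act (h j l x) (act (?P x) (act (v l) m)))"
      by (simp add: R.sum R.scale L.sum L.scale del: scale_scale)
    finally show ?thesis by (simp add: f.sum f.scale mult.commute)
  qed
  moreover have "homogeneous_fun X (j + 1) (\<lambda>x. \<Sum>l<N. f (act (?P x) (act (v l) m)) * h j l x)"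
    by (intro homogeneous_fun_sum homogeneous_fun_mult Suc.IH Suc.prems) auto
  ultimately show ?case by simp
qed

text \<open>The product is multilinear in its factors, so factors from the generating set
  \<open>S\<close> suffice. The vector \<open>m\<close> stays fixed, which the argument for
  \<open>Soc_pow\<close> requires.\<close>

lemma act_prod_in_span:
  fixes j :: nat
  assumes act: "Modules.module act"
    and u: "\<And>i. i < j \<Longrightarrow> u i \<in> Modules.module.span kscale S"
  shows "act (\<Prod>i<j. u i) m \<in>
    Modules.module.span (restrict_scalars act) {act (\<Prod>i<j. s i) m | s. \<forall>i<j. s i \<in> S}"
  using u
proof (induction j)
  case 0
  interpret M: vector_space "restrict_scalars act" by (rule vector_space_restrict_scalars[OF act])
  show ?case by (auto intro: M.span_base)
next
  case (Suc j)
  interpret Modules.module act by fact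
  interpret M: vector_space "restrict_scalars act" by (rule vector_space_restrict_scalars[OF act])
  interpret A: vector_space kscale by (rule vector_space_restrict_scalars[OF module_times])
  interpret L: Vector_Spaces.linear "restrict_scalars act" "restrict_scalars act" "act z" for z
    by (rule linear_act[OF act])
  interpret R: Vector_Spaces.linear kscale "restrict_scalars act" "\<lambda>x. act x z" for z
    by (rule linear_act_left[OF act])
  define T where "T j = {act (\<Prod>i<j. s i) m | s. \<forall>i<j. s i \<in> S}" for j :: nat
  have extend: "act s w \<in> M.span (T (Suc j))" if s: "s \<in> S" and w: "w \<in> M.span (T j)" for s w
    using w
  proof (induction rule: M.span_induct_alt)
    case base
    show ?case by (simp add: M.span_zero)
  next
    case (step c x w)
    then obtain t where t: "\<forall>i<j. t i \<in> S" "x = act (\<Prod>i<j. t i) m" by (auto simp: T_def)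
    have "act s x = act (\<Prod>i<Suc j. (t(j := s)) i) m"
      by (simp add: t(2) mult.commute)
    moreover have "\<forall>i<Suc j. (t(j := s)) i \<in> S" using t(1) s by auto
    ultimately have "act s x \<in> T (Suc j)" unfolding T_def by blast
    then show ?case
      using step by (simp add: L.add L.scale M.span_add M.span_scale M.span_base del: scale_scale)
  qed
  \<comment> \<open>Linearity in the acting element passes from \<open>S\<close> to its
    span.\<close>
  have "act x w \<in> M.span (T (Suc j))" if "x \<in> A.span S" "w \<in> M.span (T j)" for x w
    using that(1)
  proof (induction rule: A.span_induct_alt)
    case base
    show ?case by (simp add: M.span_zero)
  next
    case (step c s x)
    then show ?case
      using \<open>w \<in> M.span (T j)\<close> by (simp add: R.add R.scale M.span_add M.span_scale extend del: scale_scale)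
  qed
  moreover have "u j \<in> A.span S" "act (\<Prod>i<j. u i) m \<in> M.span (T j)"
    using Suc by (simp_all add: T_def)
  ultimately have "act (u j) (act (\<Prod>i<j. u i) m) \<in> M.span (T (Suc j))"
    by blast
  moreover have "act (u j) (act (\<Prod>i<j. u i) m) = act (\<Prod>i<Suc j. u i) m"
    by (simp add: mult.commute)
  ultimately show ?case by (simp only: T_def)
qed

text \<open>Naming the factors by indices makes their selection independent of the subspace, so that
  it can label one polynomial function for all subspaces.\<close>

lemma act_prod_in_span_family:
  fixes j r :: nat
  assumes act: "Modules.module act"
    and u: "\<And>i. i < j \<Longrightarrow> u i \<in> Modules.module.span kscale (w ` {..<r})"
  shows "act (\<Prod>i<j. u i) m \<in>
    Modules.module.span (restrict_scalars act) {act (\<Prod>i<j. w (t i)) m | t. \<forall>i<j. t i < r}"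
proof -
  have "{act (\<Prod>i<j. s i) m | s. \<forall>i<j. s i \<in> w ` {..<r}} = {act (\<Prod>i<j. w (t i)) m | t. \<forall>i<j. t i < r}"
  proof (intro equalityI subsetI)
    fix y assume "y \<in> {act (\<Prod>i<j. s i) m | s. \<forall>i<j. s i \<in> w ` {..<r}}"
    then obtain s where s: "\<forall>i<j. s i \<in> w ` {..<r}" "y = act (\<Prod>i<j. s i) m" by blast
    then have "\<forall>i\<in>{..<j}. \<exists>l. l < r \<and> s i = w l" by auto
    from bchoice[OF this] obtain t where t: "\<forall>i\<in>{..<j}. t i < r \<and> s i = w (t i)" by blast
    then have "y = act (\<Prod>i<j. w (t i)) m" by (simp add: s(2))
    then show "y \<in> {act (\<Prod>i<j. w (t i)) m | t. \<forall>i<j. t i < r}" using t by blast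
  qed force
  then show ?thesis using act_prod_in_span[OF act, where j = j and u = u and m = m, OF u] by simp
qed

lemma subspace_Soc_pow:
  assumes "Modules.module act"
  shows "Modules.module.subspace (restrict_scalars act) (Soc_pow act j U)"
proof -
  interpret M: vector_space "restrict_scalars act" by (rule vector_space_restrict_scalars[OF assms])
  interpret L: Vector_Spaces.linear "restrict_scalars act" "restrict_scalars act" "act z" for z
    by (rule linear_act[OF assms])
  show ?thesis
    by (auto simp: M.subspace_def Soc_pow_def L.add L.scale)
qed

section \<open>Closedness of bounds on the dimensions of radicals and socles\<close>

context
  fixes act :: "('e::{comm_monoid_add, finite} \<Rightarrow>\<^sub>0 'k::field) \<Rightarrow> 'm::ab_group_add \<Rightarrow> 'm"
    and B :: "'m set" and V :: "('e \<Rightarrow>\<^sub>0 'k) set"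
  assumes act: "Modules.module act"
    and B: "finite B" "Modules.module.span (restrict_scalars act) B = UNIV"
    and V: "Modules.module.subspace kscale V"
begin

interpretation M: vector_space "restrict_scalars act"
  by (rule vector_space_restrict_scalars[OF act])

interpretation A: vector_space "kscale :: 'k \<Rightarrow> ('e \<Rightarrow>\<^sub>0 'k) \<Rightarrow> _"
  by (rule vector_space_restrict_scalars[OF module_times])


text \<open>
  The factors of the entry \<open>(a, b)\<close> are selected by \<open>s a b\<close>: for \<open>Rad\<close> the selection depends on
  the column \<open>b\<close> only, for \<open>Soc\<close> on the row \<open>a\<close> only.
\<close>
lemma product_det_locus_closed:
  fixes T :: "(nat \<Rightarrow> nat \<Rightarrow> nat \<Rightarrow> nat) set"
  assumes T: "\<And>s a b i. s \<in> T \<Longrightarrow> a < d \<Longrightarrow> b < d \<Longrightarrow> i < j \<Longrightarrow> s a b i < r"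
    and zero: "\<And>U w s f m. U \<in> Grass r V \<Longrightarrow> D U \<Longrightarrow> (\<And>i. i < r \<Longrightarrow> w i \<in> U) \<Longrightarrow> s \<in> T \<Longrightarrow>
      (\<And>a. a < d \<Longrightarrow> Vector_Spaces.linear (restrict_scalars act) (*) (f a)) \<Longrightarrow>
      det (mat d d (\<lambda>(a, b). f a (act (\<Prod>i<j. w (s a b i)) (m b)))) = 0"
    and D: "\<And>U w. U \<in> Grass r V \<Longrightarrow> (\<And>i. i < r \<Longrightarrow> w i \<in> U) \<Longrightarrow> U \<subseteq> A.span (w ` {..<r}) \<Longrightarrow>
      (\<And>s f m. s \<in> T \<Longrightarrow> (\<And>a. a < d \<Longrightarrow> Vector_Spaces.linear (restrict_scalars act) (*) (f a)) \<Longrightarrow>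
        det (mat d d (\<lambda>(a, b). f a (act (\<Prod>i<j. w (s a b i)) (m b)))) = 0) \<Longrightarrow> D U"
  shows "zariski_closed_Grass r V {U \<in> Grass r V. D U}"
proof -
  obtain C :: "('e \<Rightarrow>\<^sub>0 'k) set" where C: "finite C" "A.span C = UNIV"
    using kscale_finite_spanning by blast
  obtain vs where vs: "ordered_basis kscale vs V"
    using A.ordered_basis_exists[OF C V] .
  let ?X = "{I. I \<subseteq> {..<length vs} \<and> card I = r}"
  obtain h :: "(nat \<Rightarrow> nat) \<Rightarrow> nat \<Rightarrow> nat \<Rightarrow> (nat set \<Rightarrow> 'k) \<Rightarrow> 'k"
    where hom: "\<And>c i l. (\<And>b. b < r \<Longrightarrow> c b < length vs) \<Longrightarrow> l < length vs \<Longrightarrow> homogeneous_fun ?X 1 (h c i l)"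
    and gen_in: "\<And>c i us U. (\<And>b. b < r \<Longrightarrow> c b < length vs) \<Longrightarrow> i < r \<Longrightarrow>
      ordered_basis kscale us U \<Longrightarrow> U \<subseteq> V \<Longrightarrow> A.dim U = r \<Longrightarrow>
      (\<Sum>l<length vs. kscale (h c i l (pluecker kscale vs us)) (vs ! l)) \<in> U"
    and gen_span: "\<And>us U. ordered_basis kscale us U \<Longrightarrow> U \<subseteq> V \<Longrightarrow> A.dim U = r \<Longrightarrow>
      \<exists>c. (\<forall>b<r. c b < length vs) \<and>
        U \<subseteq> A.span ((\<lambda>i. \<Sum>l<length vs. kscale (h c i l (pluecker kscale vs us)) (vs ! l)) ` {..<r})"
    using A.pluecker_generators[OF C vs, of r] by blast
  define w where "w c x i = (\<Sum>l<length vs. kscale (h c i l x) (vs ! l))" for c x i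
  \<comment> \<open>The entries have degree \<open>j\<close> in the Pluecker coordinates, so this
    determinant is homogeneous of degree \<open>d * j\<close>.\<close>
  define g where "g c s f m x = det (mat d d (\<lambda>(a, b). f a (act (\<Prod>i<j. w c x (s a b i)) (m b))))"
    for c :: "nat \<Rightarrow> nat" and s :: "nat \<Rightarrow> nat \<Rightarrow> nat \<Rightarrow> nat" and f :: "nat \<Rightarrow> 'm \<Rightarrow> 'k" and m :: "nat \<Rightarrow> 'm" and x
  let ?G = "{g c s f m | c s f m. (\<forall>b<r. c b < length vs) \<and> s \<in> T \<and>
    (\<forall>a<d. Vector_Spaces.linear (restrict_scalars act) (*) (f a))}"
  have Grass: "U \<subseteq> V" "A.dim U = r" "A.subspace U" if "U \<in> Grass r V" for U
    using that by (auto simp: Grass_def)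
  show ?thesis
  proof (rule zariski_closed_GrassI[OF vs, where G = ?G and d = "d * j"])
    fix G assume "G \<in> ?G"
    then obtain c s f m where G: "G = g c s f m" and c: "\<forall>b<r. c b < length vs" and "s \<in> T"
      and f: "\<forall>a<d. Vector_Spaces.linear (restrict_scalars act) (*) (f a)" by blast
    have "homogeneous_fun ?X (d * j)
        (\<lambda>x. det (mat d d (\<lambda>(a, b). f a (act (\<Prod>i<j. w c x (s a b i)) (m b)))))"
      unfolding w_def
      by (intro homogeneous_fun_det homogeneous_fun_act_prod[OF act] hom) (use c f in auto)
    then show "homogeneous_fun ?X (d * j) G" unfolding G g_def[abs_def] .
  next
    fix U us G
    assume U: "U \<in> {U \<in> Grass r V. D U}" and us: "ordered_basis kscale us U" and "G \<in> ?G"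
    then obtain c s f m where G: "G = g c s f m" and c: "\<forall>b<r. c b < length vs" and s: "s \<in> T"
      and f: "\<forall>a<d. Vector_Spaces.linear (restrict_scalars act) (*) (f a)" by blast
    show "G (pluecker kscale vs us) = 0"
      unfolding G g_def
    proof (rule zero[OF _ _ _ s])
      show "U \<in> Grass r V" "D U" using U by auto
      \<comment> \<open>For an arbitrary \<open>c\<close> these vectors may fail to span
        \<open>U\<close>; \<open>zero\<close> asks only that they lie in it.\<close>
      show "w c (pluecker kscale vs us) i \<in> U" if "i < r" for i
        unfolding w_def using c gen_in[OF _ that us] Grass U by blast
    qed (use f in auto)
  next
    fix U
    assume U: "U \<in> Grass r V" and G: "\<And>us G. ordered_basis kscale us U \<Longrightarrow> G \<in> ?G \<Longrightarrow> G (pluecker kscale vs us) = 0"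
    obtain us where us: "ordered_basis kscale us U"
      using A.ordered_basis_exists[OF C Grass(3)[OF U]] .
    let ?x = "pluecker kscale vs us"
    \<comment> \<open>In this direction one selection whose vectors span \<open>U\<close> is enough
      to apply \<open>D\<close>.\<close>
    obtain c where c: "\<forall>b<r. c b < length vs" and span: "U \<subseteq> A.span (w c ?x ` {..<r})"
      using gen_span[OF us Grass(1,2)[OF U]] unfolding w_def[abs_def] by blast
    have "D U"
    proof (rule D[OF U _ span])
      show "w c ?x i \<in> U" if "i < r" for i
        unfolding w_def using c gen_in[OF _ that us] Grass U by blast
      fix s :: "nat \<Rightarrow> nat \<Rightarrow> nat \<Rightarrow> nat" and f m
      assume "s \<in> T" "\<And>a. a < d \<Longrightarrow> Vector_Spaces.linear (restrict_scalars act) (*) (f a)"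
      then have "g c s f m ?x = 0"
        using c by (intro G[OF us]) blast
      then show "det (mat d d (\<lambda>(a, b). f a (act (\<Prod>i<j. w c ?x (s a b i)) (m b)))) = 0"
        by (simp add: g_def)
    qed
    then show "U \<in> {U \<in> Grass r V. D U}" using U by simp
  qed simp
qed

text \<open>Coordinates with respect to a basis are linear functionals and determine the
  vector.\<close>

lemma linear_functionals_separate:
  assumes "\<And>f. Vector_Spaces.linear (restrict_scalars act) (*) f \<Longrightarrow> f w = 0"
  shows "w = 0"
proof -
  let ?E = "M.extend_basis {}"
  have E: "M.independent ?E" "M.span ?E = UNIV"
    by (rule M.independent_extend_basis[OF M.independent_empty], rule M.span_extend_basis[OF M.independent_empty])
  have "M.representation ?E w b = 0" for b
    by (rule assms[OF M.linear_representation[OF E]])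
  then show ?thesis
    using M.sum_nonzero_representation_eq[OF E(1), of w] by (simp add: E(2))
qed

text \<open>When the \<open>w i\<close> generate \<open>U\<close>, the vectors
  \<open>act (\<Prod>i<j. w (t i)) m\<close> span \<open>Rad_pow act j U\<close>. Its dimension is
  below \<open>d\<close> exactly when all \<open>d\<close> by \<open>d\<close> determinants of
  functionals on such vectors vanish.\<close>

lemma Rad_pow_dim_less_closed:
  "zariski_closed_Grass r V {U \<in> Grass r V. M.dim (Rad_pow act j U) < d}"
proof (rule product_det_locus_closed[where d = d and j = j
      and T = "{\<lambda>a::nat. s | s. \<forall>b<d. \<forall>i<j. s b i < r}"])
  fix U w and s :: "nat \<Rightarrow> nat \<Rightarrow> nat \<Rightarrow> nat" and f :: "nat \<Rightarrow> 'm \<Rightarrow> 'k" and m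
  assume dim: "M.dim (Rad_pow act j U) < d" and w: "\<And>i. i < r \<Longrightarrow> w i \<in> U"
    and s: "s \<in> {\<lambda>a::nat. s | s. \<forall>b<d. \<forall>i<j. s b i < r}"
    and f: "\<And>a. a < d \<Longrightarrow> Vector_Spaces.linear (restrict_scalars act) (*) (f a)"
  from s obtain t where t: "s = (\<lambda>a. t)" "\<forall>b<d. \<forall>i<j. t b i < r" by blast
  show "det (mat d d (\<lambda>(a, b). f a (act (\<Prod>i<j. w (s a b i)) (m b)))) = 0"
  proof (rule ccontr)
    assume "det (mat d d (\<lambda>(a, b). f a (act (\<Prod>i<j. w (s a b i)) (m b)))) \<noteq> 0"
    then have det: "det (mat d d (\<lambda>(a, b). f a (act (\<Prod>i<j. w (t b i)) (m b)))) \<noteq> 0"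
      by (simp add: t(1))
    \<comment> \<open>With \<open>K = {0}\<close> the pairing bound says that the \<open>d\<close>
      vectors are independent.\<close>
    have "d + M.dim {0} \<le> M.dim (Rad_pow act j U)"
    proof (rule M.det_pairing_dim[OF B _ _ f _ _ _ det])
      show sub: "M.subspace (Rad_pow act j U)" by (simp add: Rad_pow_def)
      show "M.subspace {0}" "{0} \<subseteq> Rad_pow act j U"
        using M.subspace_0[OF sub] by auto
      show "act (\<Prod>i<j. w (t b i)) (m b) \<in> Rad_pow act j U" if "b < d" for b
        unfolding Rad_pow_def using that t w by (intro M.span_base) blast
      show "f a v = 0" if "a < d" "v \<in> {0}" for a v
        using Vector_Spaces.linear_iff[of "restrict_scalars act" "(*)" "f a"] f[OF that(1)] that(2)
        by (metis add_cancel_right_right singletonD)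
    qed
    then show False using dim by simp
  qed
next
  fix U and w :: "nat \<Rightarrow> 'e \<Rightarrow>\<^sub>0 'k"
  assume w: "\<And>i. i < r \<Longrightarrow> w i \<in> U" "U \<subseteq> A.span (w ` {..<r})"
    and zero: "\<And>s f m. s \<in> {\<lambda>a::nat. s | s. \<forall>b<d. \<forall>i<j. s b i < r} \<Longrightarrow>
      (\<And>a. a < d \<Longrightarrow> Vector_Spaces.linear (restrict_scalars act) (*) (f a)) \<Longrightarrow>
      det (mat d d (\<lambda>(a, b). f a (act (\<Prod>i<j. w (s a b i)) (m b)))) = 0"
  show "M.dim (Rad_pow act j U) < d"
  proof (rule ccontr)
    assume neg: "\<not> M.dim (Rad_pow act j U) < d"
    \<comment> \<open>By multilinearity the factors may be restricted to the \<open>w i\<close>,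
      while \<open>m\<close> still ranges over the whole module.\<close>
    let ?Y = "{act (\<Prod>i<j. w (t i)) m | t m. \<forall>i<j. t i < r}"
    have "Rad_pow act j U \<subseteq> M.span ?Y"
      unfolding Rad_pow_def
    proof (rule M.span_minimal)
      show "{act (\<Prod>i<j. u i) m | u m. \<forall>i<j. u i \<in> U} \<subseteq> M.span ?Y"
      proof safe
        fix u m assume "\<forall>i<j. u i \<in> U"
        then have "act (\<Prod>i<j. u i) m \<in> M.span {act (\<Prod>i<j. w (t i)) m | t. \<forall>i<j. t i < r}"
          using w(2) by (intro act_prod_in_span_family[OF act]) blast
        also have "\<dots> \<subseteq> M.span ?Y" by (intro M.span_mono) blast
        finally show "act (\<Prod>i<j. u i) m \<in> M.span ?Y" .
      qed
    qed simp
    moreover have "?Y \<subseteq> Rad_pow act j U"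
      unfolding Rad_pow_def using w(1) by (auto intro!: M.span_base)
    then have "M.span ?Y \<subseteq> Rad_pow act j U"
      by (rule M.span_minimal) (simp add: Rad_pow_def)
    ultimately have Rad: "M.span ?Y = Rad_pow act j U"
      by (intro equalityI)
    let ?\<Psi> = "{f. Vector_Spaces.linear (restrict_scalars act) (*) f}"
    have "{v \<in> M.span ?Y. \<forall>f\<in>?\<Psi>. f v = 0} \<subseteq> M.span {}"
      using linear_functionals_separate by auto
    then have dim0: "M.dim {v \<in> M.span ?Y. \<forall>f\<in>?\<Psi>. f v = 0} = 0"
      using M.dim_le_card[of _ "{}"] by fastforce
    have "d \<le> M.dim (M.span ?Y)"
      unfolding Rad using neg by simp
    with dim0 have "d + M.dim {v \<in> M.span ?Y. \<forall>f\<in>?\<Psi>. f v = 0} \<le> M.dim (M.span ?Y)"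
      by linarith
    then obtain y f where y: "\<forall>b<d. y b \<in> ?Y" and f: "\<forall>a<d. f a \<in> ?\<Psi>"
      and det: "det (mat d d (\<lambda>(a, b). f a (y b))) \<noteq> 0"
      using M.det_pairing_exists[OF B, of ?\<Psi> d ?Y] by blast
    have "\<forall>b. \<exists>t m. b < d \<longrightarrow> y b = act (\<Prod>i<j. w (t i)) m \<and> (\<forall>i<j. t i < r)"
      using y by blast
    then obtain t m where t: "\<And>b. b < d \<Longrightarrow> y b = act (\<Prod>i<j. w (t b i)) (m b)"
      "\<And>b. b < d \<Longrightarrow> \<forall>i<j. t b i < r"
      by metis
    have "mat d d (\<lambda>(a, b). f a (y b)) = mat d d (\<lambda>(a, b). f a (act (\<Prod>i<j. w (t b i)) (m b)))"
      by (intro eq_matI) (auto simp: t(1))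
    moreover have "det (mat d d (\<lambda>(a, b). f a (act (\<Prod>i<j. w (t b i)) (m b)))) = 0"
      using zero[of "\<lambda>a. t" f m] f t(2) by auto
    ultimately show False using det by simp
  qed
qed blast

text \<open>Dually to the radical, the socle is the common kernel of the functionals
  \<open>f \<circ> act (\<Prod>i<j. w (t i))\<close> when the \<open>w i\<close> generate
  \<open>U\<close>, so a large socle means a small rank of this family.\<close>

lemma Soc_pow_dim_greater_closed:
  "zariski_closed_Grass r V {U \<in> Grass r V. M.dim (Soc_pow act j U) > q}"
proof -
  \<comment> \<open>Dimension above \<open>q\<close> means rank below this \<open>d\<close>. For
    \<open>q\<close> at least \<open>M.dim UNIV\<close> the subtraction gives \<open>0\<close>; the
    determinants of size \<open>0\<close> are \<open>1\<close>, matching the empty locus.\<close>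
  define d where "d = M.dim UNIV - q"
  show ?thesis
  proof (rule product_det_locus_closed[where d = d and j = j
        and T = "{\<lambda>a (b::nat). s a | s. \<forall>a<d. \<forall>i<j. s a i < r}"])
    fix U w and s :: "nat \<Rightarrow> nat \<Rightarrow> nat \<Rightarrow> nat" and f :: "nat \<Rightarrow> 'm \<Rightarrow> 'k" and m
    assume dim: "M.dim (Soc_pow act j U) > q" and w: "\<And>i. i < r \<Longrightarrow> w i \<in> U"
      and s: "s \<in> {\<lambda>a (b::nat). s a | s. \<forall>a<d. \<forall>i<j. s a i < r}"
      and f: "\<And>a. a < d \<Longrightarrow> Vector_Spaces.linear (restrict_scalars act) (*) (f a)"
    from s obtain t where t: "s = (\<lambda>a b. t a)" "\<forall>a<d. \<forall>i<j. t a i < r" by blast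
    show "det (mat d d (\<lambda>(a, b). f a (act (\<Prod>i<j. w (s a b i)) (m b)))) = 0"
    proof (rule ccontr)
      assume "det (mat d d (\<lambda>(a, b). f a (act (\<Prod>i<j. w (s a b i)) (m b)))) \<noteq> 0"
      then have det: "det (mat d d (\<lambda>(a, b). (f a \<circ> act (\<Prod>i<j. w (t a i))) (m b))) \<noteq> 0"
        by (simp add: t(1))
      \<comment> \<open>The pairing bound is applied with the whole module as \<open>W\<close> and
        the socle as \<open>K\<close>.\<close>
      have "d + M.dim (Soc_pow act j U) \<le> M.dim UNIV"
      proof (rule M.det_pairing_dim[OF B _ _ _ _ _ _ det])
        show "Vector_Spaces.linear (restrict_scalars act) (*) (f a \<circ> act (\<Prod>i<j. w (t a i)))" if "a < d" for a
          by (rule Vector_Spaces.linear_compose[OF linear_act[OF act] f[OF that]])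
        show "(f a \<circ> act (\<Prod>i<j. w (t a i))) v = 0" if "a < d" "v \<in> Soc_pow act j U" for a v
        proof -
          interpret fa: Vector_Spaces.linear "restrict_scalars act" "(*)" "f a" by (rule f[OF that(1)])
          have "\<forall>i<j. w (t a i) \<in> U" using t(2) w that(1) by blast
          then have "act (\<Prod>i<j. w (t a i)) v = 0" using that(2) by (simp add: Soc_pow_def)
          then show ?thesis by (simp add: fa.zero)
        qed
      qed (auto simp: subspace_Soc_pow[OF act])
      then show False using dim by (simp add: d_def)
    qed
  next
    fix U and w :: "nat \<Rightarrow> 'e \<Rightarrow>\<^sub>0 'k"
    assume w: "\<And>i. i < r \<Longrightarrow> w i \<in> U" "U \<subseteq> A.span (w ` {..<r})"
      and zero: "\<And>s f m. s \<in> {\<lambda>a (b::nat). s a | s. \<forall>a<d. \<forall>i<j. s a i < r} \<Longrightarrow>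
        (\<And>a. a < d \<Longrightarrow> Vector_Spaces.linear (restrict_scalars act) (*) (f a)) \<Longrightarrow>
        det (mat d d (\<lambda>(a, b). f a (act (\<Prod>i<j. w (s a b i)) (m b)))) = 0"
    show "M.dim (Soc_pow act j U) > q"
    proof (rule ccontr)
      assume neg: "\<not> M.dim (Soc_pow act j U) > q"
      \<comment> \<open>Composing with all functionals turns membership in the socle into the
        vanishing of scalars; the common kernel of \<open>?\<Psi>\<close> therefore lies in
        \<open>Soc_pow act j U\<close>.\<close>
      let ?\<Psi> = "{f \<circ> act (\<Prod>i<j. w (t i)) | f t.
        Vector_Spaces.linear (restrict_scalars act) (*) f \<and> (\<forall>i<j. t i < r)}"
      have "{v \<in> M.span UNIV. \<forall>f\<in>?\<Psi>. f v = 0} \<subseteq> Soc_pow act j U"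
      proof
        fix v assume v: "v \<in> {v \<in> M.span UNIV. \<forall>f\<in>?\<Psi>. f v = 0}"
        have gen: "act (\<Prod>i<j. w (t i)) v = 0" if "\<forall>i<j. t i < r" for t
          by (rule linear_functionals_separate) (use v that in fastforce)
        have "act (\<Prod>i<j. u i) v = 0" if u: "\<forall>i<j. u i \<in> U" for u
        proof -
          have "act (\<Prod>i<j. u i) v \<in> M.span {act (\<Prod>i<j. w (t i)) v | t. \<forall>i<j. t i < r}"
            using w(2) u by (intro act_prod_in_span_family[OF act]) blast
          also have "\<dots> \<subseteq> M.span {0}" using gen by (intro M.span_mono) blast
          finally show ?thesis by simp
        qed
        then show "v \<in> Soc_pow act j U" by (simp add: Soc_pow_def)
      qed
      then have "M.dim {v \<in> M.span UNIV. \<forall>f\<in>?\<Psi>. f v = 0} \<le> M.dim (Soc_pow act j U)"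
        by (rule M.dim_mono_of_spanning[OF B])
      \<comment> \<open>If \<open>q\<close> exceeds \<open>M.dim UNIV\<close>, then
        \<open>d = 0\<close> and monotonicity of the dimension gives the bound.\<close>
      then have "d + M.dim {v \<in> M.span UNIV. \<forall>f\<in>?\<Psi>. f v = 0} \<le> M.dim (M.span UNIV)"
        using neg M.dim_mono_of_spanning[OF B, of "Soc_pow act j U" UNIV] by (simp add: d_def)
      moreover have "Vector_Spaces.linear (restrict_scalars act) (*) f" if "f \<in> ?\<Psi>" for f
        using that by (auto intro!: Vector_Spaces.linear_compose[OF linear_act[OF act]])
      ultimately obtain y g where g: "\<forall>a<d. g a \<in> ?\<Psi>"
        and det: "det (mat d d (\<lambda>(a, b). g a (y b))) \<noteq> 0"
        using M.det_pairing_exists[OF B, of ?\<Psi> d UNIV] by blast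
      have "\<forall>a. \<exists>f t. a < d \<longrightarrow> g a = f \<circ> act (\<Prod>i<j. w (t i)) \<and>
          Vector_Spaces.linear (restrict_scalars act) (*) f \<and> (\<forall>i<j. t i < r)"
        using g by blast
      then obtain f t where t: "\<And>a. a < d \<Longrightarrow> g a = f a \<circ> act (\<Prod>i<j. w (t a i))"
        "\<And>a. a < d \<Longrightarrow> Vector_Spaces.linear (restrict_scalars act) (*) (f a)"
        "\<And>a. a < d \<Longrightarrow> \<forall>i<j. t a i < r"
        by metis
      have "mat d d (\<lambda>(a, b). g a (y b)) = mat d d (\<lambda>(a, b). f a (act (\<Prod>i<j. w (t a i)) (y b)))"
        by (intro eq_matI) (auto simp: t(1))
      moreover have "det (mat d d (\<lambda>(a, b). f a (act (\<Prod>i<j. w (t a i)) (y b)))) = 0"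
        using zero[of "\<lambda>a b. t a" f y] t(2,3) by auto
      ultimately show False using det by simp
    qed
  qed blast
qed

end

theorem corollary2p5:
  fixes p n r j :: nat
    and V :: "('e::{ab_group_add, finite} \<Rightarrow>\<^sub>0 'k::alg_closed_field) set"
    and act :: "('e \<Rightarrow>\<^sub>0 'k) \<Rightarrow> 'm::ab_group_add \<Rightarrow> 'm"
  assumes char_k: "CHAR('k) = p" "p > 0"
    and elementary_abelian_E: "\<And>x::'e. (\<Sum>i<p. x) = 0"
    and rank_E: "card (UNIV :: 'e set) = p ^ n" "n \<ge> 1"
    and V: "radical_complement V"
    and r: "1 \<le> r" "r \<le> n"
    and module_M: "Modules.module act"
    and finite_dim_M: "\<exists>B. finite B \<and> Modules.module.span (restrict_scalars act) B = UNIV"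
    and j: "j > 0"
  shows "zariski_closed_Grass r V (Rad_locus act j r V) \<and>
         zariski_closed_Grass r V (Soc_locus act j r V)"
proof -
  obtain B where B: "finite B" "Modules.module.span (restrict_scalars act) B = UNIV"
    using finite_dim_M by blast
  have V': "Modules.module.subspace kscale V"
    using V by (simp add: radical_complement_def)
  \<comment> \<open>Each locus is given by a numerical bound: the maximum takes the place of
    \<open>d\<close>, the minimum that of \<open>q\<close>.\<close>
  show ?thesis
    unfolding Rad_locus_def Soc_locus_def
    by (intro conjI Rad_pow_dim_less_closed[OF module_M B V'] Soc_pow_dim_greater_closed[OF module_M B V'])
qed

end
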